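(* Let $n \geq 4$. If $\mathcal{A}, \mathcal{B} \subset S_n$ is a cross-intersecting pair of families satisfying $|\mathcal{A}||\mathcal{B}| = ((n-1)!)^2$, then there exist $i, j \in [n]$ such that \[\mathcal{A} = \mathcal{B} = \{\sigma \in S_n : \sigma(i) = j\}.\]
   Context: $S_n$ is the symmetric group on $[n]=\{1,\ldots,n\}$. A pair of families $\mathcal{A},\mathcal{B} \subset S_n$ is cross-intersecting if for every $\sigma \in \mathcal{A}$ and every $\tau \in \mathcal{B}$ there is some $i \in [n]$ with $\sigma(i) = \tau(i)$. *)

theory Defs
  imports "HOL-Combinatorics.Permutations"
begin

definition sym_grp :: "nat \<Rightarrow> (nat \<Rightarrow> nat) set" where
  "sym_grp n = {\<sigma>. \<sigma> permutes {1..n}}"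

definition cross_intersecting :: "nat \<Rightarrow> (nat \<Rightarrow> nat) set \<Rightarrow> (nat \<Rightarrow> nat) set \<Rightarrow> bool" where
  "cross_intersecting n A B \<longleftrightarrow>
     (\<forall>\<sigma>\<in>A. \<forall>\<tau>\<in>B. \<exists>i\<in>{1..n}. \<sigma> i = \<tau> i)"

end

theory Submission
  imports Defs "HOL-Library.Function_Algebras"
    "HOL-Computational_Algebra.Fundamental_Theorem_Algebra"
begin

text \<open>
  For \<open>n \<ge> 5\<close> the proof is a ratio bound of Hoffman type for a weighted derangement graph whose
  spectrum is accessible without representation theory. The weighted adjacency operator \<open>M\<close> is a
  symmetric polynomial in the Jucys--Murphy operators \<open>J\<^sub>k = \<Sum>i<k. (i k)\<close>, so its eigenvalues can be
  read off from the joint eigenvalues of \<open>J\<^sub>2, \<dots>, J\<^sub>n\<close>. With \<open>\<mu> = mu n\<close>, the constants have eigenvalue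
  \<open>(n - 1) \<mu>\<close>, the functions \<open>\<sigma> \<mapsto> \<Sum>i. a i (\<sigma> i)\<close> of mean zero have eigenvalue \<open>- \<mu>\<close>, and all other
  eigenvalues are smaller than \<open>\<mu>\<close> in absolute value. As \<open>\<langle>M 1\<^sub>B, 1\<^sub>A\<rangle> = 0\<close> for cross-intersecting
  families, equality in the bound forces \<open>A = B\<close> and \<open>1\<^sub>A \<sigma> = \<Sum>i. a i (\<sigma> i)\<close>. For such an
  indicator function the effect of exchanging two values depends only on the two positions and the two
  values, and an intersecting family with this property fixes the image of a point.

  For \<open>n = 4\<close> the only class weighting giving the sharp bound has further eigenvalues of absolute
  value \<open>\<mu>\<close>, on the sign character and on the two-dimensional representation; this case is settled
  by a finite search.
\<close>

section \<open>Eigenvector decompositions in complex vector spaces\<close>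

text \<open>A bound for two different families needs both ends of the spectrum. Let
  \<open>f\<close>, \<open>g\<close> be the centred indicators of \<open>A\<close>,
  \<open>B\<close>, rescaled to equal norm. Polarization writes \<open>4 Re <M g, f>\<close> as
  \<open><M (f + g), f + g> - <M (f - g), f - g>\<close>; the first form is bounded below through
  the eigenvalue \<open>- mu n\<close>, the second above through \<open>mu n\<close>. In the
  equality case the lower bound is attained, which makes \<open>f + g\<close> linear, and so is the
  upper one, which no nonzero function of mean zero attains; so \<open>f = g\<close>. The sum of all
  \<open>n\<close>-cycles alone already has the ratio \<open>- 1 / (n - 1)\<close> between the
  eigenvalue on the standard representation and that on the constants. It fails because its
  eigenvalue on the sign character is as large in absolute value as on the constants. Hence the
  second summand of opposite parity, scaled to cancel the first on the sign character; the same
  scaling also cancels on the product of sign and standard representation. This operator cannot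
  serve for \<open>n = 4\<close>: there the contents \<open>0, 1, -1, 0\<close> give eigenvalue
  \<open>3\<close>, while \<open>mu 4 = 2\<close>.\<close>

locale complex_vector_space = vector_space scale
  for scale :: "complex \<Rightarrow> 'v::ab_group_add \<Rightarrow> 'v" (infixr "*s" 75)
begin

definition linear_op :: "('v \<Rightarrow> 'v) \<Rightarrow> bool" where
  "linear_op T \<longleftrightarrow> (\<forall>x y. T (x + y) = T x + T y) \<and> (\<forall>c x. T (c *s x) = c *s T x)"

lemma linear_op_add: "linear_op T \<Longrightarrow> T (x + y) = T x + T y"
  and linear_op_scale: "linear_op T \<Longrightarrow> T (c *s x) = c *s T x"
  by (auto simp: linear_op_def)

lemma linear_op_zero: "linear_op T \<Longrightarrow> T 0 = 0"
  using linear_op_scale[of T 0 0] by simp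

lemma linear_op_minus: "linear_op T \<Longrightarrow> T (- x) = - T x"
  using linear_op_scale[of T "-1" x] by simp

lemma linear_op_diff: "linear_op T \<Longrightarrow> T (x - y) = T x - T y"
  using linear_op_add[of T x "-y"] linear_op_minus[of T y] by simp

lemma linear_op_sum: "linear_op T \<Longrightarrow> T (sum f I) = (\<Sum>i\<in>I. T (f i))"
  by (induction I rule: infinite_finite_induct) (auto simp: linear_op_zero linear_op_add)

text \<open>A polynomial in \<open>T\<close> in factored form, so that an induction can strip one
  root at a time.\<close>

fun shift_ops :: "('v \<Rightarrow> 'v) \<Rightarrow> complex list \<Rightarrow> 'v \<Rightarrow> 'v" where
  "shift_ops T [] x = x"
| "shift_ops T (z # zs) x = shift_ops T zs (T x - z *s x)"

text \<open>The cutoff \<open>m\<close> replaces the degree: with it, multiplication by a linear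
  factor is a mere shift of indices from \<open>m\<close> to \<open>Suc m\<close>.\<close>

definition poly_op :: "nat \<Rightarrow> complex poly \<Rightarrow> ('v \<Rightarrow> 'v) \<Rightarrow> 'v \<Rightarrow> 'v" where
  "poly_op m p T x = (\<Sum>i<m. coeff p i *s (T ^^ i) x)"

lemma linear_op_funpow: "linear_op T \<Longrightarrow> linear_op (T ^^ i)"
  by (induction i) (auto simp: linear_op_def)

lemma poly_op_linear_factor:
  assumes T: "linear_op T" and m: "degree q < m"
  shows "poly_op (Suc m) ([:-z, 1:] * q) T x = poly_op m q T (T x - z *s x)"
proof -
  have c: "coeff ([:-z, 1:] * q) i = (case i of 0 \<Rightarrow> 0 | Suc j \<Rightarrow> coeff q j) - z * coeff q i" for i
    by (simp add: coeff_pCons split: nat.splits)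
  have "poly_op (Suc m) ([:-z, 1:] * q) T x
     = (\<Sum>i<Suc m. (case i of 0 \<Rightarrow> 0 | Suc j \<Rightarrow> coeff q j) *s (T ^^ i) x)
       - (\<Sum>i<Suc m. (z * coeff q i) *s (T ^^ i) x)"
    unfolding poly_op_def c by (simp add: scale_left_diff_distrib sum_subtractf del: sum.lessThan_Suc)
  also have "(\<Sum>i<Suc m. (case i of 0 \<Rightarrow> 0 | Suc j \<Rightarrow> coeff q j) *s (T ^^ i) x)
     = (\<Sum>i<m. coeff q i *s (T ^^ i) (T x))"
    by (subst sum.lessThan_Suc_shift) (simp add: funpow_swap1)
  also have "(\<Sum>i<Suc m. (z * coeff q i) *s (T ^^ i) x) = (\<Sum>i<m. coeff q i *s (T ^^ i) (z *s x))"
    using m by (simp add: coeff_eq_0 linear_op_scale[OF linear_op_funpow[OF T]] mult.commute)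
  finally show ?thesis
    by (simp add: poly_op_def linear_op_diff[OF linear_op_funpow[OF T]] scale_right_diff_distrib sum_subtractf)
qed

lemma degree_prod_list_linear: "degree (prod_list (map (\<lambda>z. [:-z, 1:]) zs)) = length (zs :: complex list)"
proof (induction zs)
  case (Cons z zs)
  have "prod_list (map (\<lambda>z. [:-z, 1:]) zs) \<noteq> (0 :: complex poly)"
    by (auto simp: prod_list_zero_iff)
  then have "degree ([:-z, 1:] * prod_list (map (\<lambda>z. [:-z, 1:]) zs)) = 1 + length zs"
    using Cons by (subst degree_mult_eq) auto
  then show ?case by simp
qed auto

lemma poly_op_prod_list:
  assumes "linear_op T"
  shows "poly_op (Suc (length zs)) (prod_list (map (\<lambda>z. [:-z, 1:]) zs)) T x = shift_ops T zs x"
proof (induction zs arbitrary: x)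
  case Nil
  then show ?case by (simp add: poly_op_def)
next
  case (Cons z zs)
  have "poly_op (Suc (Suc (length zs))) ([:-z, 1:] * prod_list (map (\<lambda>z. [:-z, 1:]) zs)) T x
     = shift_ops T (z # zs) x"
    by (subst poly_op_linear_factor) (auto simp: assms degree_prod_list_linear Cons simp del: mult_pCons_left)
  then show ?case by simp
qed

text \<open>There are \<open>card b + 1\<close> terms in the span of \<open>card b\<close> vectors.
  Linear dependence is a notion for sets, so a sequence with a repetition is treated separately;
  there \<open>v i - v j = 0\<close> is the relation.\<close>

lemma dependent_sequence:
  assumes fin: "finite b" and v: "\<And>i. v i \<in> span b"
  obtains a :: "nat \<Rightarrow> complex" and m where "m \<le> card b" "a m \<noteq> 0" "(\<Sum>i\<le>card b. a i *s v i) = 0"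
proof (cases "inj_on v {..card b}")
  case True
  have "dependent (v ` {..card b})"
  proof (rule ccontr)
    assume "\<not> dependent (v ` {..card b})"
    then have "card (v ` {..card b}) \<le> card b"
      using independent_span_bound[OF fin, of "v ` {..card b}"] v by blast
    then show False using card_image[OF True] by simp
  qed
  then obtain u where u: "\<exists>y\<in>v ` {..card b}. u y \<noteq> 0" "(\<Sum>y\<in>v ` {..card b}. u y *s y) = 0"
    using dependent_finite[of "v ` {..card b}"] by blast
  from u(1) obtain m where "m \<le> card b" "u (v m) \<noteq> 0" by auto
  with u(2) show ?thesis by (intro that[of m "u \<circ> v"]) (auto simp: sum.reindex[OF True])
next
  case False
  then obtain i j where ij: "i \<le> card b" "j \<le> card b" "i \<noteq> j" "v i = v j"
    by (auto simp: inj_on_def)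
  let ?a = "\<lambda>k. (if k = i then 1 else 0) - (if k = j then 1 else 0 :: complex)"
  have "(\<Sum>k\<le>card b. ?a k *s v k) = (\<Sum>k\<le>card b. (if k = i then v k else 0)) - (\<Sum>k\<le>card b. (if k = j then v k else 0))"
    unfolding sum_subtractf[symmetric] by (intro sum.cong) (auto)
  also have "\<dots> = 0" using ij by simp
  finally show ?thesis using ij by (intro that[of i ?a]) auto
qed

text \<open>The iterates of \<open>T\<close> on \<open>x\<close> are linearly dependent, which gives
  a nonzero polynomial \<open>p\<close> with \<open>p(T) x = 0\<close>; over the complex numbers it
  splits, and its roots form \<open>zs\<close>.\<close>

lemma shift_ops_annihilate:
  assumes T: "linear_op T" and fin: "finite b" and Sb: "S \<subseteq> span b"
    and TS: "\<And>x. x \<in> S \<Longrightarrow> T x \<in> S" and x: "x \<in> S"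
  obtains zs where "shift_ops T zs x = 0"
proof -
  have "(T ^^ i) x \<in> S" for i by (induction i) (auto simp: x TS)
  then have "(T ^^ i) x \<in> span b" for i using Sb by blast
  then obtain a m where a: "m \<le> card b" "a m \<noteq> 0" "(\<Sum>i\<le>card b. a i *s (T ^^ i) x) = 0"
    using dependent_sequence[OF fin, of "\<lambda>i. (T ^^ i) x"] by metis
  define p where "p = (\<Sum>i\<le>card b. monom (a i) i)"
  have cp: "coeff p i = (if i \<le> card b then a i else 0)" for i
    by (simp add: p_def coeff_sum)
  have p0: "p \<noteq> 0" using a(1,2) cp[of m] by auto
  have "degree p \<le> card b" by (rule degree_le) (simp add: cp)
  have z: "poly_op (Suc (degree p)) p T x = 0"
  proof -
    have "(\<Sum>i\<le>card b. coeff p i *s (T ^^ i) x) = poly_op (Suc (degree p)) p T x"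
      unfolding poly_op_def using \<open>degree p \<le> card b\<close>
      by (intro sum.mono_neutral_right) (auto simp: coeff_eq_0)
    moreover have "(\<Sum>i\<le>card b. coeff p i *s (T ^^ i) x) = (\<Sum>i\<le>card b. a i *s (T ^^ i) x)"
      by (intro sum.cong) (auto simp: cp)
    ultimately show ?thesis using a(3) by simp
  qed
  obtain Z where Z: "size Z = degree p" "p = smult (lead_coeff p) (\<Prod>z\<in>#Z. [:-z, 1:])"
    using alg_closed_imp_factorization[OF p0] by blast
  obtain zs where zs: "mset zs = Z" using ex_mset by blast
  have "p = smult (lead_coeff p) (prod_list (map (\<lambda>z. [:-z, 1:]) zs))"
    using Z(2) zs by (metis mset_map prod_mset_prod_list)
  moreover have "degree p = length zs" using Z(1) zs by auto
  moreover have "poly_op m (smult d q) T x = d *s poly_op m q T x" for m d q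
    by (simp add: poly_op_def scale_sum_right)
  ultimately have "lead_coeff p *s shift_ops T zs x = 0"
    using z poly_op_prod_list[OF T, of zs x] by metis
  then show ?thesis using p0 by (intro that[of zs]) simp
qed

text \<open>Absence of Jordan chains of length two: \<open>(T - z)^2 x = 0\<close> implies
  \<open>(T - z) x = 0\<close>. In this form the property passes to subsets of \<open>S\<close> at
  once.\<close>

definition semisimple_on :: "'v set \<Rightarrow> ('v \<Rightarrow> 'v) \<Rightarrow> bool" where
  "semisimple_on S T \<longleftrightarrow>
     (\<forall>z. \<forall>x\<in>S. T (T x - z *s x) = z *s (T x - z *s x) \<longrightarrow> T x = z *s x)"

text \<open>By induction \<open>(T - z) x\<close> is a sum of eigenvectors. Dividing the component
  for each \<open>w\<close> other than \<open>z\<close> by \<open>w - z\<close> gives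
  \<open>y\<close> such that \<open>(T - z) (x - y)\<close> is the remaining component, for
  \<open>z\<close>; semisimplicity then makes \<open>x - y\<close> itself an eigenvector for
  \<open>z\<close>.\<close>

lemma shift_ops_eigen_decomposition:
  assumes T: "linear_op T" and S: "subspace S" and TS: "\<And>x. x \<in> S \<Longrightarrow> T x \<in> S"
    and ss: "semisimple_on S T" and "x \<in> S" "shift_ops T zs x = 0"
  shows "\<exists>Z F. finite Z \<and> x = sum F Z \<and> (\<forall>z\<in>Z. F z \<in> S \<and> T (F z) = z *s F z)"
  using assms(5,6)
proof (induction zs arbitrary: x)
  case Nil
  then show ?case by (intro exI[of _ "{}"]) auto
next
  case (Cons z zs)
  let ?u = "T x - z *s x"
  have "?u \<in> S" using S TS Cons.prems(1) by (simp add: subspace_diff subspace_scale)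
  with Cons obtain Z F where Z: "finite Z" "?u = sum F Z"
    and F: "\<And>w. w \<in> Z \<Longrightarrow> F w \<in> S" "\<And>w. w \<in> Z \<Longrightarrow> T (F w) = w *s F w"
    by (metis shift_ops.simps(2))
  define y where "y = (\<Sum>w\<in>Z - {z}. (1 / (w - z)) *s F w)"
  define x' where "x' = x - y"
  have yS: "y \<in> S" unfolding y_def using F(1) S by (intro subspace_sum subspace_scale) auto
  have x'S: "x' \<in> S" using yS Cons.prems(1) S by (simp add: x'_def subspace_diff)
  have Ty: "T y - z *s y = sum F (Z - {z})"
  proof -
    have "T y - z *s y = (\<Sum>w\<in>Z - {z}. (1 / (w - z)) *s (w *s F w) - z *s ((1 / (w - z)) *s F w))"
      unfolding y_def by (simp add: linear_op_sum[OF T] linear_op_scale[OF T] F(2) sum_subtractf scale_sum_right)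
    also have "\<dots> = sum F (Z - {z})"
    proof (intro sum.cong refl)
      fix w assume "w \<in> Z - {z}"
      then have "w - z \<noteq> 0" by simp
      then have "1 / (w - z) * w - z * (1 / (w - z)) = 1" by (simp add: diff_divide_distrib[symmetric])
      then show "(1 / (w - z)) *s (w *s F w) - z *s ((1 / (w - z)) *s F w) = F w"
        unfolding scale_scale scale_left_diff_distrib[symmetric] by simp
    qed
    finally show ?thesis .
  qed
  define f where "f = (if z \<in> Z then F z else 0)"
  have "sum F Z = f + sum F (Z - {z})"
    using Z(1) by (auto simp: f_def sum.remove)
  then have "T x' - z *s x' = f"
    using Z(2) Ty unfolding x'_def by (simp add: linear_op_diff[OF T] scale_right_diff_distrib algebra_simps)
  moreover have "T f = z *s f" using F(2)[of z] by (auto simp: f_def linear_op_zero[OF T])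
  ultimately have e: "T x' = z *s x'" using ss x'S by (auto simp: semisimple_on_def)
  define F' where "F' w = (if w = z then x' else (1 / (w - z)) *s F w)" for w
  have "sum F' (Z - {z}) = y" unfolding y_def by (intro sum.cong) (auto simp: F'_def)
  then have "x = sum F' (insert z Z)"
    using Z(1) by (simp add: sum.insert_remove F'_def x'_def)
  moreover have "F' w \<in> S \<and> T (F' w) = w *s F' w" if "w \<in> insert z Z" for w
    using that x'S e F S by (auto simp: F'_def subspace_scale linear_op_scale[OF T] mult.commute)
  ultimately show ?case using Z(1) by (intro exI[of _ "insert z Z"] exI[of _ F']) auto
qed

lemma eigen_decomposition:
  assumes T: "linear_op T" and S: "subspace S" and "finite b" "S \<subseteq> span b" 
    and TS: "\<And>x. x \<in> S \<Longrightarrow> T x \<in> S"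
    and ss: "semisimple_on S T" and x: "x \<in> S"
  shows "\<exists>Z F. finite Z \<and> x = sum F Z \<and> (\<forall>z\<in>Z. F z \<in> S \<and> T (F z) = z *s F z)"
proof -
  obtain zs where "shift_ops T zs x = 0"
    using shift_ops_annihilate[OF T assms(3,4) TS x] .
  then show ?thesis using T S TS ss x by (intro shift_ops_eigen_decomposition) auto
qed

definition joint_eigen :: "(nat \<Rightarrow> 'v \<Rightarrow> 'v) \<Rightarrow> nat \<Rightarrow> (nat \<Rightarrow> complex) \<Rightarrow> 'v \<Rightarrow> bool" where
  "joint_eigen T m c x \<longleftrightarrow> (\<forall>k\<in>{1..m}. T k x = c k *s x)"

text \<open>Induction on the number of operators: the next operator commutes with the earlier ones,
  hence preserves each of their joint eigenspaces, and it can be diagonalized inside it.\<close>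

lemma joint_eigen_span:
  assumes T: "\<And>k. linear_op (T k)" and S: "subspace S" and b: "finite b" "S \<subseteq> span b" 
    and TS: "\<And>k x. k \<in> {1..m} \<Longrightarrow> x \<in> S \<Longrightarrow> T k x \<in> S"
    and ss: "\<And>k. k \<in> {1..m} \<Longrightarrow> semisimple_on S (T k)" 
    and comm: "\<And>k l x. k \<in> {1..m} \<Longrightarrow> l \<in> {1..m} \<Longrightarrow> T k (T l x) = T l (T k x)"
  shows "S \<subseteq> span {x \<in> S. \<exists>c. joint_eigen T m c x}"
  using TS ss comm
proof (induction m)
  case 0
  have "S \<subseteq> span S" by (rule span_superset)
  then show ?case by (simp add: joint_eigen_def)
next
  case (Suc m)
  have "S \<subseteq> span {x \<in> S. \<exists>c. joint_eigen T m c x}"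
    using Suc.prems by (intro Suc.IH) auto
  also have "\<dots> \<subseteq> span {x \<in> S. \<exists>c. joint_eigen T (Suc m) c x}"
  proof (rule span_minimal[OF _ subspace_span], safe)
    fix x c assume x: "x \<in> S" and c: "joint_eigen T m c x"
    let ?S = "{y \<in> S. joint_eigen T m c y}"
    have S1: "subspace ?S"
      using S by (auto simp: subspace_def joint_eigen_def linear_op_zero[OF T] linear_op_add[OF T]
          linear_op_scale[OF T] scale_right_distrib mult.commute)
    have S2: "?S \<subseteq> span b" using b by auto
    have S3: "T (Suc m) y \<in> ?S" if "y \<in> ?S" for y
    proof -
      have "T k (T (Suc m) y) = c k *s T (Suc m) y" if "k \<in> {1..m}" for k
        using Suc.prems(3)[of k "Suc m" y] \<open>y \<in> ?S\<close> that
        by (auto simp: joint_eigen_def linear_op_scale[OF T])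
      then show ?thesis using that Suc.prems(1) by (auto simp: joint_eigen_def)
    qed
    have S4: "semisimple_on ?S (T (Suc m))"
      using Suc.prems(2)[of "Suc m"] by (auto simp: semisimple_on_def)
    have S5: "x \<in> ?S" using x c by simp
    obtain Z F where Z: "finite Z" "x = sum F Z" "\<forall>z\<in>Z. F z \<in> ?S \<and> T (Suc m) (F z) = z *s F z"
      using eigen_decomposition[OF T S1 b(1) S2 S3 S4 S5] by blast
    show "x \<in> span {x \<in> S. \<exists>c. joint_eigen T (Suc m) c x}"
      unfolding Z(2)
    proof (intro span_sum span_base CollectI conjI)
      fix z assume z: "z \<in> Z"
      then show "F z \<in> S" using Z(3) by auto
      have "joint_eigen T (Suc m) (c(Suc m := z)) (F z)"
        using Z(3) z by (auto simp: joint_eigen_def le_Suc_eq)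
      then show "\<exists>c. joint_eigen T (Suc m) c (F z)" by blast
    qed
  qed
  finally show ?case .
qed

end

section \<open>Jucys--Murphy operators on functions of permutations\<close>

type_synonym perm_fun = "(nat \<Rightarrow> nat) \<Rightarrow> complex"

definition fscale :: "complex \<Rightarrow> perm_fun \<Rightarrow> perm_fun" where
  "fscale c f = (\<lambda>x. c * f x)"

lemma fscale_apply [simp]: "fscale c f x = c * f x"
  by (simp add: fscale_def)

interpretation fv: complex_vector_space fscale
  by standard (auto simp: fun_eq_iff algebra_simps)

lemma sum_fun_apply: "sum f I x = (\<Sum>i\<in>I. f i x)" for f :: "'i \<Rightarrow> 'a \<Rightarrow> 'b::comm_monoid_add"
  by (induction I rule: infinite_finite_induct) auto

definition rtrans :: "(nat \<Rightarrow> nat) \<Rightarrow> perm_fun \<Rightarrow> perm_fun" where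
  "rtrans \<tau> f = (\<lambda>\<sigma>. f (\<sigma> \<circ> \<tau>))"

lemma rtrans_apply: "rtrans \<tau> f \<sigma> = f (\<sigma> \<circ> \<tau>)"
  by (simp add: rtrans_def)

lemma rtrans_rtrans: "rtrans \<tau> (rtrans \<rho> f) = rtrans (\<tau> \<circ> \<rho>) f"
  by (simp add: rtrans_def comp_assoc)

lemma rtrans_id [simp]: "rtrans id f = f"
  by (simp add: rtrans_def)

lemma linear_rtrans: "fv.linear_op (rtrans \<tau>)"
  by (auto simp: fv.linear_op_def rtrans_def fun_eq_iff)

definition jm :: "nat \<Rightarrow> perm_fun \<Rightarrow> perm_fun" where
  "jm k f = (\<Sum>i=1..<k. rtrans (transpose i k) f)"

lemma jm_apply: "jm k f \<sigma> = (\<Sum>i=1..<k. f (\<sigma> \<circ> transpose i k))"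
  by (simp add: jm_def sum_fun_apply rtrans_apply)

lemma linear_jm: "fv.linear_op (jm k)"
  by (auto simp: fv.linear_op_def fun_eq_iff jm_apply sum.distrib sum_distrib_left)

lemma jm_1 [simp]: "jm (Suc 0) f = 0" "jm 0 f = 0"
  by (simp_all add: jm_def)

lemma comp_transpose_eq: "bij f \<Longrightarrow> f \<circ> transpose a b = transpose (f a) (f b) \<circ> f"
  by (auto simp: fun_eq_iff transpose_def bij_def inj_eq)

text \<open>Conjugation by a permutation of \<open>{1..<l}\<close> only permutes the transpositions
  \<open>(i l)\<close> with \<open>i < l\<close>.\<close>

lemma jm_rtrans_commute:
  assumes "\<tau> permutes {1..<l}"
  shows "jm l (rtrans \<tau> f) = rtrans \<tau> (jm l f)"
proof
  fix \<sigma>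
  have l: "\<tau> l = l" using assms by (rule permutes_not_in) simp
  have "rtrans \<tau> (jm l f) \<sigma> = (\<Sum>i=1..<l. f (\<sigma> \<circ> (\<tau> \<circ> transpose i l)))"
    by (simp add: rtrans_apply jm_apply comp_assoc)
  also have "\<dots> = (\<Sum>i=1..<l. f (\<sigma> \<circ> transpose (\<tau> i) l \<circ> \<tau>))"
    by (simp add: comp_transpose_eq[OF permutes_bij[OF assms]] l comp_assoc)
  also have "\<dots> = (\<Sum>i=1..<l. f (\<sigma> \<circ> transpose i l \<circ> \<tau>))"
    by (rule sum.reindex_bij_betw[OF permutes_imp_bij[OF assms]])
  finally show "jm l (rtrans \<tau> f) \<sigma> = rtrans \<tau> (jm l f) \<sigma>"
    by (simp add: rtrans_apply jm_apply)
qed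

lemma jm_commute: "jm k (jm l f) = jm l (jm k f)"
proof -
  have *: "jm k (jm l f) = jm l (jm k f)" if "k < l" for k l
  proof -
    have "jm l (jm k f) = (\<Sum>i=1..<k. jm l (rtrans (transpose i k) f))"
      unfolding jm_def[of k] by (simp add: fv.linear_op_sum[OF linear_jm])
    also have "\<dots> = (\<Sum>i=1..<k. rtrans (transpose i k) (jm l f))"
      using that by (intro sum.cong refl jm_rtrans_commute permutes_swap_id) auto
    finally show ?thesis by (simp add: jm_def[of k])
  qed
  show ?thesis using *[of k l] *[of l k] by (cases k l rule: linorder_cases) auto
qed

abbreviation adj :: "nat \<Rightarrow> perm_fun \<Rightarrow> perm_fun" where
  "adj k \<equiv> rtrans (transpose k (Suc k))"

lemma adj_adj [simp]: "adj k (adj k f) = f"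
  by (simp add: rtrans_rtrans)

lemma adj_jm_commute:
  assumes "1 \<le> k" "j \<noteq> k" "j \<noteq> Suc k"
  shows "adj k (jm j f) = jm j (adj k f)"
proof (cases "j < k")
  case True
  show ?thesis
  proof
    fix \<sigma> :: "nat \<Rightarrow> nat"
    have "\<sigma> \<circ> transpose k (Suc k) \<circ> transpose i j = \<sigma> \<circ> transpose i j \<circ> transpose k (Suc k)" if "i < j" for i
      using True that by (simp add: comp_assoc swap_id_independent)
    then show "adj k (jm j f) \<sigma> = jm j (adj k f) \<sigma>"
      by (simp add: rtrans_apply jm_apply)
  qed
next
  case False
  then show ?thesis using assms by (intro jm_rtrans_commute[symmetric] permutes_swap_id) auto
qed

text \<open>Conjugating \<open>(i k)\<close> by the adjacent transposition gives
  \<open>(i k+1)\<close>; the only summand of \<open>jm (Suc k)\<close> not obtained is the adjacent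
  transposition itself, which accounts for \<open>- f\<close>. This is the relation of the
  degenerate affine Hecke algebra.\<close>

lemma adj_jm:
  assumes "1 \<le> k"
  shows "adj k (jm k f) = jm (Suc k) (adj k f) - f"
proof
  fix \<sigma> :: "nat \<Rightarrow> nat"
  have "\<sigma> \<circ> transpose k (Suc k) \<circ> transpose i k = \<sigma> \<circ> transpose i (Suc k) \<circ> transpose k (Suc k)"
    if "i < k" for i
    using that by (auto simp: fun_eq_iff transpose_def)
  then have "adj k (jm k f) \<sigma> = (\<Sum>i=1..<k. f (\<sigma> \<circ> transpose i (Suc k) \<circ> transpose k (Suc k)))"
    by (simp add: rtrans_apply jm_apply)
  moreover have "jm (Suc k) (adj k f) \<sigma> = (\<Sum>i=1..<k. f (\<sigma> \<circ> transpose i (Suc k) \<circ> transpose k (Suc k))) + f \<sigma>"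
    using assms by (simp add: jm_apply rtrans_apply sum.atLeastLessThan_Suc comp_assoc)
  ultimately show "adj k (jm k f) \<sigma> = (jm (Suc k) (adj k f) - f) \<sigma>" by simp
qed

lemma jm_adj:
  assumes "1 \<le> k"
  shows "jm k (adj k f) = adj k (jm (Suc k) f) - f"
proof -
  have "adj k (jm k (adj k f)) = jm (Suc k) f - adj k f"
    using adj_jm[OF assms, of "adj k f"] by simp
  then have "adj k (adj k (jm k (adj k f))) = adj k (jm (Suc k) f) - adj k (adj k f)"
    by (simp only: fv.linear_op_diff[OF linear_rtrans])
  then show ?thesis by simp
qed

lemma adj_braid: "adj k (adj (Suc k) (adj k f)) = adj (Suc k) (adj k (adj (Suc k) f))"
  unfolding rtrans_rtrans
  by (rule arg_cong[of _ _ "\<lambda>\<tau>. rtrans \<tau> f"]) (auto simp: fun_eq_iff transpose_def)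

section \<open>The finite-dimensional space of functions on the symmetric group and its Hermitian
  form\<close>

definition perm_funs :: "nat \<Rightarrow> perm_fun set" where
  "perm_funs n = {f. \<forall>\<sigma>. \<sigma> \<notin> sym_grp n \<longrightarrow> f \<sigma> = 0}"

lemma subspace_perm_funs: "fv.subspace (perm_funs n)"
  by (auto simp: fv.subspace_def perm_funs_def)

lemma finite_sym_grp [simp]: "finite (sym_grp n)"
  by (simp add: sym_grp_def finite_permutations)

lemma card_sym_grp: "card (sym_grp n) = fact n"
  by (simp add: sym_grp_def card_permutations)

definition delta :: "(nat \<Rightarrow> nat) \<Rightarrow> perm_fun" where
  "delta \<tau> = (\<lambda>\<sigma>. if \<sigma> = \<tau> then 1 else 0)"

lemma perm_funs_eq_sum_delta:
  assumes "f \<in> perm_funs n"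
  shows "f = (\<Sum>\<tau>\<in>sym_grp n. fscale (f \<tau>) (delta \<tau>))"
proof
  fix \<sigma>
  have "(\<Sum>\<tau>\<in>sym_grp n. fscale (f \<tau>) (delta \<tau>)) \<sigma> = (\<Sum>\<tau>\<in>sym_grp n. if \<sigma> = \<tau> then f \<tau> else 0)"
    unfolding sum_fun_apply by (intro sum.cong) (auto simp: delta_def)
  also have "\<dots> = f \<sigma>" using assms by (auto simp: perm_funs_def)
  finally show "f \<sigma> = (\<Sum>\<tau>\<in>sym_grp n. fscale (f \<tau>) (delta \<tau>)) \<sigma>" by simp
qed

lemma perm_funs_span: "perm_funs n \<subseteq> fv.span (delta ` sym_grp n)"
proof
  fix f assume "f \<in> perm_funs n"
  then have "f = (\<Sum>\<tau>\<in>sym_grp n. fscale (f \<tau>) (delta \<tau>))" by (rule perm_funs_eq_sum_delta)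
  also have "\<dots> \<in> fv.span (delta ` sym_grp n)"
    by (intro fv.span_sum fv.span_scale fv.span_base) auto
  finally show "f \<in> fv.span (delta ` sym_grp n)" .
qed

lemma sym_grp_comp_iff:
  assumes "\<tau> \<in> sym_grp n"
  shows "\<sigma> \<circ> \<tau> \<in> sym_grp n \<longleftrightarrow> \<sigma> \<in> sym_grp n"
proof
  assume "\<sigma> \<circ> \<tau> \<in> sym_grp n"
  then have "(\<sigma> \<circ> \<tau>) \<circ> inv \<tau> permutes {1..n}"
    using assms permutes_compose[OF permutes_inv] unfolding sym_grp_def by blast
  moreover have "(\<sigma> \<circ> \<tau>) \<circ> inv \<tau> = \<sigma>"
    using assms by (simp add: sym_grp_def comp_assoc permutes_inv_o)
  ultimately show "\<sigma> \<in> sym_grp n" by (simp add: sym_grp_def)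
next
  show "\<sigma> \<in> sym_grp n \<Longrightarrow> \<sigma> \<circ> \<tau> \<in> sym_grp n"
    using assms by (auto simp: sym_grp_def intro: permutes_compose)
qed

lemma transpose_in_sym_grp: "i \<in> {1..n} \<Longrightarrow> j \<in> {1..n} \<Longrightarrow> transpose i j \<in> sym_grp n"
  by (simp add: sym_grp_def permutes_swap_id)

lemma rtrans_perm_funs: "\<tau> \<in> sym_grp n \<Longrightarrow> f \<in> perm_funs n \<Longrightarrow> rtrans \<tau> f \<in> perm_funs n"
  by (auto simp: perm_funs_def rtrans_apply sym_grp_comp_iff)

lemma jm_perm_funs: "k \<le> n \<Longrightarrow> f \<in> perm_funs n \<Longrightarrow> jm k f \<in> perm_funs n"
  unfolding jm_def
  by (intro fv.subspace_sum[OF subspace_perm_funs] rtrans_perm_funs transpose_in_sym_grp) auto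

definition inner :: "nat \<Rightarrow> perm_fun \<Rightarrow> perm_fun \<Rightarrow> complex" where
  "inner n f g = (\<Sum>\<sigma>\<in>sym_grp n. f \<sigma> * cnj (g \<sigma>))"

lemma inner_add_left: "inner n (f + g) h = inner n f h + inner n g h"
  and inner_add_right: "inner n h (f + g) = inner n h f + inner n h g"
  and inner_diff_left: "inner n (f - g) h = inner n f h - inner n g h"
  and inner_diff_right: "inner n h (f - g) = inner n h f - inner n h g"
  and inner_scale_left: "inner n (fscale c f) h = c * inner n f h"
  and inner_scale_right: "inner n h (fscale c f) = cnj c * inner n h f"
  and inner_zero_left: "inner n 0 h = 0"
  and inner_zero_right: "inner n h 0 = 0"
  by (simp_all add: inner_def algebra_simps sum.distrib sum_subtractf sum_distrib_left)

lemma inner_commute: "inner n g f = cnj (inner n f g)"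
  by (simp add: inner_def mult.commute)

lemma inner_sum_left: "inner n (sum F I) h = (\<Sum>i\<in>I. inner n (F i) h)"
  unfolding inner_def sum_fun_apply sum_distrib_right by (rule sum.swap)

lemma inner_sum_right: "inner n h (sum F I) = (\<Sum>i\<in>I. inner n h (F i))"
  unfolding inner_def sum_fun_apply cnj_sum sum_distrib_left by (rule sum.swap)

definition norm_sq :: "nat \<Rightarrow> perm_fun \<Rightarrow> real" where
  "norm_sq n f = (\<Sum>\<sigma>\<in>sym_grp n. (cmod (f \<sigma>))\<^sup>2)"

lemma inner_self: "inner n f f = of_real (norm_sq n f)"
  by (simp add: inner_def norm_sq_def complex_norm_square del: of_real_power)

lemma norm_sq_nonneg: "norm_sq n f \<ge> 0"
  by (simp add: norm_sq_def sum_nonneg)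

lemma norm_sq_eq_0_iff:
  assumes "f \<in> perm_funs n"
  shows "norm_sq n f = 0 \<longleftrightarrow> f = 0"
proof
  assume "norm_sq n f = 0"
  then have "\<forall>\<sigma>\<in>sym_grp n. f \<sigma> = 0"
    by (simp add: norm_sq_def sum_nonneg_eq_0_iff)
  with assms show "f = 0" by (auto simp: perm_funs_def fun_eq_iff)
qed (simp add: norm_sq_def)

lemma inner_rtrans_transpose:
  assumes "i \<in> {1..n}" "j \<in> {1..n}"
  shows "inner n (rtrans (transpose i j) f) g = inner n f (rtrans (transpose i j) g)"
proof -
  have t: "transpose i j \<in> sym_grp n" using assms by (rule transpose_in_sym_grp)
  have b: "bij_betw (\<lambda>\<sigma>. \<sigma> \<circ> transpose i j) (sym_grp n) (sym_grp n)"
    by (rule bij_betwI[where g = "\<lambda>\<sigma>. \<sigma> \<circ> transpose i j"])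
       (auto simp: sym_grp_comp_iff[OF t] comp_assoc)
  have "inner n f (rtrans (transpose i j) g)
      = (\<Sum>\<sigma>\<in>sym_grp n. f (\<sigma> \<circ> transpose i j) * cnj (rtrans (transpose i j) g (\<sigma> \<circ> transpose i j)))"
    unfolding inner_def by (rule sum.reindex_bij_betw[OF b, symmetric])
  then show ?thesis by (simp add: inner_def rtrans_apply comp_assoc)
qed

lemma inner_jm: "k \<le> n \<Longrightarrow> inner n (jm k f) g = inner n f (jm k g)"
  unfolding jm_def inner_sum_left inner_sum_right
  by (intro sum.cong refl inner_rtrans_transpose) auto

definition self_adjoint :: "nat \<Rightarrow> (perm_fun \<Rightarrow> perm_fun) \<Rightarrow> bool" where
  "self_adjoint n T \<longleftrightarrow> (\<forall>f g. inner n (T f) g = inner n f (T g))"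

lemma self_adjoint_eigenvalue_real:
  assumes "self_adjoint n T" "T f = fscale z f" "f \<in> perm_funs n" "f \<noteq> 0"
  shows "cnj z = z"
proof -
  have "z * inner n f f = cnj z * inner n f f"
    using assms(1,2) by (metis self_adjoint_def inner_scale_left inner_scale_right)
  moreover have "inner n f f \<noteq> 0" using assms(3,4) by (simp add: inner_self norm_sq_eq_0_iff)
  ultimately show ?thesis by simp
qed

text \<open>If \<open>g = (T - z) f\<close> satisfies \<open>T g = z g\<close> and is nonzero, then
  \<open>z\<close> is real, so \<open><g, g> = <f, (T - z) g> = 0\<close>.\<close>

lemma self_adjoint_semisimple:
  assumes T: "self_adjoint n T" "fv.linear_op T" and S: "fv.subspace S" "S \<subseteq> perm_funs n"
    and TS: "\<And>f. f \<in> S \<Longrightarrow> T f \<in> S"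
  shows "fv.semisimple_on S T"
  unfolding fv.semisimple_on_def
proof (intro allI ballI impI, rule ccontr)
  fix z f assume f: "f \<in> S" and e: "T (T f - fscale z f) = fscale z (T f - fscale z f)"
    and ne: "T f \<noteq> fscale z f"
  let ?g = "T f - fscale z f"
  have g: "?g \<in> perm_funs n" "?g \<noteq> 0"
    using f S TS ne by (auto intro: fv.subspace_diff fv.subspace_scale)
  have z: "cnj z = z" by (rule self_adjoint_eigenvalue_real[OF T(1) e g])
  have "inner n ?g ?g = inner n (T f) ?g - z * inner n f ?g"
    by (subst inner_diff_left) (simp add: inner_scale_left)
  also have "\<dots> = inner n f (T ?g) - z * inner n f ?g" using T(1) by (simp add: self_adjoint_def)
  also have "\<dots> = 0" by (simp only: e inner_scale_right z) simp
  finally show False using g by (simp add: inner_self norm_sq_eq_0_iff)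
qed

section \<open>Contents of joint eigenvectors\<close>

text \<open>
  In terms of Young tableaux \<open>c k\<close> is the content (column minus row) of the box containing \<open>k\<close>;
  the lemmas below recover the possible contents directly from the relations between the
  Jucys--Murphy operators and the adjacent transpositions, following Okounkov and Vershik.
\<close>

definition content_vector :: "nat \<Rightarrow> (nat \<Rightarrow> complex) \<Rightarrow> perm_fun \<Rightarrow> bool" where
  "content_vector n c v \<longleftrightarrow> v \<in> perm_funs n \<and> v \<noteq> 0 \<and> fv.joint_eigen jm n c v"

lemma content_vectorD:
  assumes "content_vector n c v"
  shows "v \<in> perm_funs n" "v \<noteq> 0" "k \<in> {1..n} \<Longrightarrow> jm k v = fscale (c k) v"
  using assms by (auto simp: content_vector_def fv.joint_eigen_def)

lemma self_adjoint_jm: "k \<le> n \<Longrightarrow> self_adjoint n (jm k)"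
  by (simp add: self_adjoint_def inner_jm)

lemma content_real:
  assumes "content_vector n c v" "k \<in> {1..n}"
  shows "cnj (c k) = c k"
  using self_adjoint_eigenvalue_real[OF self_adjoint_jm, of k n v "c k"] content_vectorD[OF assms(1)] assms(2)
  by auto

lemma content_1:
  assumes "content_vector n c v" "1 \<le> n"
  shows "c 1 = 0"
proof -
  have "fscale (c 1) v = 0" using content_vectorD(3)[OF assms(1), of 1] assms(2) by simp
  then show ?thesis using content_vectorD(2)[OF assms(1)] by (auto simp: fun_eq_iff)
qed

context
  fixes n k :: nat and c :: "nat \<Rightarrow> complex" and v :: perm_fun
  assumes cv: "content_vector n c v" and k: "1 \<le> k" "k < n"
begin

lemma jm_adj_content:
  "jm k (adj k v) = fscale (c (Suc k)) (adj k v) - v"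
  "jm (Suc k) (adj k v) = fscale (c k) (adj k v) + v"
proof -
  have "jm (Suc k) v = fscale (c (Suc k)) v" "jm k v = fscale (c k) v"
    using content_vectorD(3)[OF cv] k by auto
  then show "jm k (adj k v) = fscale (c (Suc k)) (adj k v) - v"
    "jm (Suc k) (adj k v) = fscale (c k) (adj k v) + v"
    using jm_adj[OF k(1), of v] adj_jm[OF k(1), of v]
    by (simp_all add: fv.linear_op_scale[OF linear_rtrans])
qed

lemma inner_self_content: "inner n v v \<noteq> 0"
  using content_vectorD(1,2)[OF cv] by (simp add: inner_self norm_sq_eq_0_iff)

lemma inner_adj: "inner n (adj k f) g = inner n f (adj k g)"
  using k by (intro inner_rtrans_transpose) auto

text \<open>Were both contents equal to \<open>c\<close>, then \<open>jm (Suc k)\<close> would map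
  \<open>adj k v\<close> to \<open>c\<close> times itself plus \<open>v\<close>, a Jordan block.
  Pairing with \<open>v\<close> and using self-adjointness gives \<open><v, v> = 0\<close>.\<close>

lemma content_Suc_neq: "c (Suc k) \<noteq> c k"
proof
  assume e: "c (Suc k) = c k"
  have "inner n (jm (Suc k) (adj k v)) v = inner n (adj k v) (jm (Suc k) v)"
    using k by (intro inner_jm) auto
  then show False
    using inner_self_content content_real[OF cv, of "Suc k"] content_vectorD(3)[OF cv, of "Suc k"] k e
    by (simp add: jm_adj_content inner_add_left inner_scale_left inner_scale_right)
qed

text \<open>The component of \<open>adj k v\<close> orthogonal to \<open>v\<close>, the intertwiner
  of Okounkov and Vershik. If it is nonzero, it is a joint eigenvector with the contents at
  \<open>k\<close> and \<open>Suc k\<close> exchanged.\<close>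

definition swapped :: perm_fun where
  "swapped = adj k v - fscale (1 / (c (Suc k) - c k)) v"

lemma swapped_perm_funs: "swapped \<in> perm_funs n"
  unfolding swapped_def using content_vectorD(1)[OF cv] k
  by (intro fv.subspace_diff fv.subspace_scale subspace_perm_funs rtrans_perm_funs transpose_in_sym_grp) auto

lemma jm_swapped:
  assumes "j \<in> {1..n}"
  shows "jm j swapped = fscale ((c \<circ> transpose k (Suc k)) j) swapped"
proof -
  define e where "e = 1 / (c (Suc k) - c k)"
  have e: "c (Suc k) * e = c k * e + 1" using content_Suc_neq by (simp add: e_def field_simps)
  have s: "swapped = adj k v - fscale e v" by (simp add: swapped_def e_def)
  have l: "jm j swapped = jm j (adj k v) - fscale e (fscale (c j) v)"
    unfolding s using content_vectorD(3)[OF cv assms]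
    by (simp add: fv.linear_op_diff[OF linear_jm] fv.linear_op_scale[OF linear_jm])
  consider "j = k" | "j = Suc k" | "j \<noteq> k" "j \<noteq> Suc k" by blast
  then show ?thesis
  proof cases
    case 1
    have "c (Suc k) * a - b - e * c k * b = c (Suc k) * (a - e * b)" for a b
    proof -
      have "c (Suc k) * (a - e * b) = c (Suc k) * a - (c (Suc k) * e) * b" by (simp add: algebra_simps)
      then show ?thesis unfolding e by (simp add: algebra_simps)
    qed
    then show ?thesis using l 1 unfolding s by (simp add: jm_adj_content fun_eq_iff)
  next
    case 2
    have "c k * a + b - e * c (Suc k) * b = c k * (a - e * b)" for a b
    proof -
      have "e * c (Suc k) * b = (c (Suc k) * e) * b" by (simp add: algebra_simps)
      then show ?thesis unfolding e by (simp add: algebra_simps)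
    qed
    then show ?thesis using l 2 unfolding s by (simp add: jm_adj_content fun_eq_iff)
  next
    case 3
    have "jm j (adj k v) = fscale (c j) (adj k v)"
      using adj_jm_commute[OF k(1) 3, of v] content_vectorD(3)[OF cv assms]
      by (simp add: fv.linear_op_scale[OF linear_rtrans])
    then show ?thesis using l 3 unfolding s by (simp add: fun_eq_iff algebra_simps)
  qed
qed

text \<open>\<open>v\<close> and \<open>swapped\<close> belong to different eigenvalues of
  \<open>jm k\<close>, hence are orthogonal, and \<open>adj k\<close> preserves the norm; so this is
  Pythagoras for \<open>adj k v\<close>. The factor vanishes exactly when the two contents differ by
  \<open>1\<close>, which separates \<open>content_swap\<close> from
  \<open>adj_content\<close>.\<close>

lemma inner_swapped: "inner n swapped swapped = (1 - 1 / (c (Suc k) - c k)\<^sup>2) * inner n v v"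
proof -
  define e where "e = 1 / (c (Suc k) - c k)"
  have s: "swapped = adj k v - fscale e v" by (simp add: swapped_def e_def)
  have r: "cnj (c k) = c k" "cnj (c (Suc k)) = c (Suc k)"
    using content_real[OF cv] k by auto
  then have re: "cnj e = e" by (simp add: e_def)
  have "inner n (jm k swapped) v = inner n swapped (jm k v)" using k by (intro inner_jm) auto
  then have "c (Suc k) * inner n swapped v = c k * inner n swapped v"
    using jm_swapped[of k] content_vectorD(3)[OF cv, of k] k r by (simp add: inner_scale_left inner_scale_right)
  then have 0: "inner n swapped v = 0" using content_Suc_neq by simp
  then have 1: "inner n (adj k v) v = e * inner n v v"
    by (simp add: s inner_diff_left inner_scale_left)
  have "inner n swapped swapped = inner n swapped (adj k v) - e * inner n swapped v"
    by (subst (2) s) (simp add: inner_diff_right inner_scale_right re)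
  also have "\<dots> = inner n (adj k v) (adj k v) - e * inner n v (adj k v)"
    using 0 by (simp add: s inner_diff_left inner_scale_left)
  also have "\<dots> = inner n v v - e * (e * inner n v v)"
    using 1 inner_adj[of v "adj k v"] inner_adj[of v v] by simp
  finally show ?thesis by (simp add: e_def power2_eq_square algebra_simps)
qed

lemma content_swap:
  assumes "(c (Suc k) - c k)\<^sup>2 \<noteq> 1"
  shows "content_vector n (c \<circ> transpose k (Suc k)) swapped"
proof -
  have "inner n swapped swapped \<noteq> 0"
    using assms inner_self_content content_Suc_neq by (simp add: inner_swapped field_simps)
  then have "swapped \<noteq> 0" by (auto simp: inner_zero_left)
  then show ?thesis
    using swapped_perm_funs jm_swapped by (auto simp: content_vector_def fv.joint_eigen_def)
qed

lemma adj_content: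
  assumes "(c (Suc k) - c k)\<^sup>2 = 1"
  shows "adj k v = fscale (c (Suc k) - c k) v"
proof -
  have "inner n swapped swapped = 0" using assms by (simp add: inner_swapped)
  then have "swapped = 0" using swapped_perm_funs by (simp add: inner_self norm_sq_eq_0_iff)
  moreover have "1 / (c (Suc k) - c k) = c (Suc k) - c k"
    using assms content_Suc_neq by (simp add: field_simps power2_eq_square)
  ultimately show ?thesis by (simp add: swapped_def)
qed

lemma adj_swapped:
  "fscale (1 - 1 / (c (Suc k) - c k)\<^sup>2) v = adj k swapped + fscale (1 / (c (Suc k) - c k)) swapped"
  unfolding swapped_def
  by (simp add: fv.linear_op_diff[OF linear_rtrans] fv.linear_op_scale[OF linear_rtrans])
     (simp add: fun_eq_iff power2_eq_square algebra_simps)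

end

text \<open>Contents \<open>a, a + d, a\<close> with \<open>d\<close> of square \<open>1\<close>
  would make two consecutive adjacent transpositions act on \<open>v\<close> as \<open>d\<close> and
  \<open>- d\<close>; the braid relation then reads \<open>- d^3 = d^3\<close>.\<close>

lemma content_no_aba:
  assumes cv: "content_vector n c v" and k: "1 \<le> k" "Suc k < n" and e: "c (Suc (Suc k)) = c k"
  shows "(c (Suc k) - c k)\<^sup>2 \<noteq> 1"
proof
  define d where "d = c (Suc k) - c k"
  assume "(c (Suc k) - c k)\<^sup>2 = 1"
  then have d: "d * d = 1" by (simp add: d_def power2_eq_square)
  have 1: "adj k v = fscale d v"
    using adj_content[OF cv k(1)] k d by (simp add: d_def power2_eq_square)
  have "(c (Suc (Suc k)) - c (Suc k))\<^sup>2 = 1" using d e by (simp add: d_def power2_eq_square algebra_simps)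
  then have 2: "adj (Suc k) v = fscale (- d) v"
    using adj_content[OF cv, of "Suc k"] k e by (simp add: d_def)
  have "fscale (d * - d * d) v = fscale (- d * d * - d) v"
    using adj_braid[of k v] unfolding 1 2 fv.linear_op_scale[OF linear_rtrans] fv.scale_scale .
  moreover obtain x where "v x \<noteq> 0" using content_vectorD(2)[OF cv] by (auto simp: fun_eq_iff)
  ultimately have "d * - d * d = - d * d * - d" by (metis fscale_apply mult_right_cancel)
  then show False using d by auto
qed

definition contents :: "nat \<Rightarrow> (nat \<Rightarrow> complex) set" where
  "contents n = {c. \<exists>v. content_vector n c v}"

lemma contents_swap:
  assumes "c \<in> contents n" "1 \<le> k" "k < n" "c (Suc k) \<noteq> c k + 1" "c (Suc k) \<noteq> c k - 1"
  shows "c \<circ> transpose k (Suc k) \<in> contents n"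
proof -
  have "(c (Suc k) - c k)\<^sup>2 \<noteq> 1"
    using assms(4,5) by (auto simp: power2_eq_1_iff algebra_simps)
  moreover obtain v where "content_vector n c v" using assms(1) by (auto simp: contents_def)
  ultimately have "content_vector n (c \<circ> transpose k (Suc k)) (swapped k c v)"
    using assms(2,3) by (intro content_swap)
  then show ?thesis unfolding contents_def by blast
qed

text \<open>
  In a shortest counterexample no entry next to either end can be swapped outwards, so the sequence
  reads \<open>a, a - d, \<dots>, a - d, a\<close>; the braid relation excludes length three.
\<close>

lemma contents_between:
  assumes "c \<in> contents n" "1 \<le> p" "p < q" "q \<le> n" "c p = c q" "d = 1 \<or> d = - 1"
  shows "\<exists>r. p < r \<and> r < q \<and> c r = c p + d"
  using assms(1-5)
proof (induction "q - p" arbitrary: c p q rule: less_induct)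
  case less
  note c = less.prems
  show ?case
  proof (rule ccontr)
    assume no: "\<not> ?thesis"
    have no_mid: "c m \<noteq> c p" if "p < m" "m < q" for m
    proof
      assume "c m = c p"
      then have "\<exists>r. p < r \<and> r < m \<and> c r = c p + d"
        using that c by (intro less.hyps) auto
      then show False using no that by (metis less_trans)
    qed
    have pq: "Suc p < q"
    proof (rule ccontr)
      assume "\<not> Suc p < q"
      then have "q = Suc p" using c by auto
      then show False using content_Suc_neq[of n c _ p] c by (auto simp: contents_def)
    qed
    have left: "c (Suc p) = c p - d"
    proof (rule ccontr)
      assume ne: "c (Suc p) \<noteq> c p - d"
      have "c (Suc p) \<noteq> c p + d" using no pq by blast
      then have "c \<circ> transpose p (Suc p) \<in> contents n"
        using c assms(6) ne pq by (intro contents_swap) auto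
      then have "\<exists>r. Suc p < r \<and> r < q \<and> (c \<circ> transpose p (Suc p)) r = (c \<circ> transpose p (Suc p)) (Suc p) + d"
        using c pq by (intro less.hyps[where c = "c \<circ> transpose p (Suc p)"]) auto
      then show False using no by auto
    qed
    have right: "c (q - 1) = c p - d"
    proof (rule ccontr)
      assume ne: "c (q - 1) \<noteq> c p - d"
      have q: "Suc (q - 1) = q" using pq by simp
      have "c (q - 1) \<noteq> c p + d" using no pq by auto
      then have "c \<circ> transpose (q - 1) (Suc (q - 1)) \<in> contents n"
        using c assms(6) ne pq by (intro contents_swap) (auto simp: algebra_simps)
      then have "c \<circ> transpose (q - 1) q \<in> contents n" by (simp only: q)
      then have "\<exists>r. p < r \<and> r < q - 1 \<and> (c \<circ> transpose (q - 1) q) r = (c \<circ> transpose (q - 1) q) p + d"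
        using c pq by (intro less.hyps[where c = "c \<circ> transpose (q - 1) q"]) auto
      then show False using no pq by auto
    qed
    show False
    proof (cases "q = Suc (Suc p)")
      case True
      then show False
        using content_no_aba[of n c _ p] c left assms(6) by (auto simp: contents_def)
    next
      case False
      then have "\<exists>r. Suc p < r \<and> r < q - 1 \<and> c r = c (Suc p) + d"
        using c pq left right by (intro less.hyps) auto
      then obtain r where "Suc p < r" "r < q - 1" "c r = c p" using left by auto
      then show False using no_mid[of r] by auto
    qed
  qed
qed

text \<open>If the entry at \<open>k\<close> is not a neighbour of the one just before it, the two
  may be swapped, which moves it one place forward. The process must stop before position
  \<open>1\<close>, where only the content \<open>0\<close> occurs.\<close>

lemma contents_neighbour_before:
  assumes "c \<in> contents n" "1 \<le> k" "k \<le> n" "c k \<noteq> 0"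
  shows "\<exists>j\<in>{1..<k}. c k = c j + 1 \<or> c k = c j - 1"
  using assms
proof (induction k arbitrary: c)
  case (Suc k)
  have "c 1 = 0" using content_1 Suc.prems by (auto simp: contents_def)
  then have k: "1 \<le> k" using Suc.prems by (cases k) auto
  show ?case
  proof (cases "c (Suc k) = c k + 1 \<or> c (Suc k) = c k - 1")
    case True
    then show ?thesis using k by (intro bexI[of _ k]) auto
  next
    case False
    then have "\<exists>j\<in>{1..<k}. (c \<circ> transpose k (Suc k)) k = (c \<circ> transpose k (Suc k)) j + 1
        \<or> (c \<circ> transpose k (Suc k)) k = (c \<circ> transpose k (Suc k)) j - 1"
      using Suc.prems k by (intro Suc.IH[of "c \<circ> transpose k (Suc k)"] contents_swap) auto
    then show ?thesis by auto
  qed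
qed auto

lemma contents_int:
  assumes "c \<in> contents n" "k \<in> {1..n}"
  shows "c k \<in> \<int>"
  using assms(2)
proof (induction k rule: less_induct)
  case (less k)
  show ?case
  proof (cases "c k = 0")
    case False
    then obtain j where j: "j \<in> {1..<k}" "c k = c j + 1 \<or> c k = c j - 1"
      using contents_neighbour_before[OF assms(1), of k] less.prems by force
    then have "c j \<in> \<int>" using less by auto
    then show ?thesis using j(2) by auto
  qed auto
qed

text \<open>The combinatorial conditions on the content vector of a standard Young tableau: between
  two boxes on the same diagonal both adjacent diagonals are visited, and a box off the main
  diagonal follows one on an adjacent diagonal.\<close>

locale content_sequence =
  fixes n :: nat and b :: "nat \<Rightarrow> int"
  assumes n: "1 \<le> n" and b_1: "b 1 = 0"
    and between: "\<And>p q d. 1 \<le> p \<Longrightarrow> p < q \<Longrightarrow> q \<le> n \<Longrightarrow> b p = b q \<Longrightarrow> \<bar>d\<bar> = 1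
      \<Longrightarrow> \<exists>r. p < r \<and> r < q \<and> b r = b p + d"
    and neighbour: "\<And>k. 1 \<le> k \<Longrightarrow> k \<le> n \<Longrightarrow> b k \<noteq> 0 \<Longrightarrow> \<exists>j\<in>{1..<k}. b k = b j + 1 \<or> b k = b j - 1"

lemma contents_content_sequence:
  assumes "c \<in> contents n" "1 \<le> n"
  obtains b where "content_sequence n b" "\<And>k. k \<in> {1..n} \<Longrightarrow> c k = of_int (b k)"
proof -
  define b where "b k = \<lfloor>Re (c k)\<rfloor>" for k
  have b: "c k = of_int (b k)" if "k \<in> {1..n}" for k
  proof -
    from contents_int[OF assms(1) that] obtain z where "c k = of_int z" by (rule Ints_cases)
    then show ?thesis by (simp add: b_def)
  qed
  have "content_sequence n b"
  proof
    show "1 \<le> n" by fact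
    have "c 1 = 0" using assms content_1 by (auto simp: contents_def)
    then show "b 1 = 0" by (simp add: b_def)
  next
    fix p q and d :: int
    assume pq: "1 \<le> p" "p < q" "q \<le> n" "b p = b q" "\<bar>d\<bar> = 1"
    then have "d = 1 \<or> d = - 1" by linarith
    then have "\<exists>r. p < r \<and> r < q \<and> c r = c p + of_int d"
      using pq b[of p] b[of q] by (intro contents_between[OF assms(1)]) auto
    then obtain r where r: "p < r" "r < q" "c r = c p + of_int d" by blast
    have "c r = of_int (b r)" "c p = of_int (b p)" using b[of r] b[of p] r(1,2) pq by auto
    then have "of_int (b r) = (of_int (b p + d) :: complex)"
      using r(3) by simp
    then show "\<exists>r. p < r \<and> r < q \<and> b r = b p + d"
      using r by (intro exI[of _ r]) (auto simp only: of_int_eq_iff)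
  next
    fix k assume k: "1 \<le> k" "k \<le> n" "b k \<noteq> 0"
    then obtain j where j: "j \<in> {1..<k}" "c k = c j + 1 \<or> c k = c j - 1"
      using contents_neighbour_before[OF assms(1), of k] b[of k] by force
    have "c k = of_int (b k)" "c j = of_int (b j)" using b[of k] b[of j] k j(1) by auto
    then have "of_int (b k) = (of_int (b j + 1) :: complex) \<or> of_int (b k) = (of_int (b j - 1) :: complex)"
      using j(2) by simp
    then show "\<exists>j\<in>{1..<k}. b k = b j + 1 \<or> b k = b j - 1"
      using j(1) by (intro bexI[of _ j]) (auto simp only: of_int_eq_iff)
  qed
  then show ?thesis using b that by blast
qed

section \<open>Eigenvalues of symmetric polynomials in the contents\<close>

text \<open>
  Index convention: at \<open>k\<close> these are the product, the elementary symmetric polynomial of degree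
  \<open>k - 1\<close> and the sum of the \<open>k\<close> variables \<open>x 2, \<dots>, x (k + 1)\<close>.
\<close>

primrec shift_prod :: "(nat \<Rightarrow> real) \<Rightarrow> nat \<Rightarrow> real" where
  "shift_prod x 0 = 1"
| "shift_prod x (Suc k) = shift_prod x k * x (k + 2)"

primrec shift_esym :: "(nat \<Rightarrow> real) \<Rightarrow> nat \<Rightarrow> real" where
  "shift_esym x 0 = 0"
| "shift_esym x (Suc k) = shift_esym x k * x (k + 2) + shift_prod x k"

primrec shift_sum :: "(nat \<Rightarrow> real) \<Rightarrow> nat \<Rightarrow> real" where
  "shift_sum x 0 = 0"
| "shift_sum x (Suc k) = shift_sum x k + x (k + 2)"

definition hsum :: "nat \<Rightarrow> real" where
  "hsum p = (\<Sum>i=1..p. 1 / real i)"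

lemma hsum_0 [simp]: "hsum 0 = 0" and hsum_Suc: "hsum (Suc p) = hsum p + 1 / real (Suc p)"
  by (simp_all add: hsum_def)

lemma fact_mult_fact_le:
  assumes "1 \<le> p" "1 \<le> m"
  shows "fact p * fact m \<le> (fact (p + m - 1) :: real)"
  using assms(1)
proof (induction p rule: dec_induct)
  case (step p)
  have "fact (Suc p) * fact m = real (Suc p) * (fact p * fact m)" by simp
  also have "\<dots> \<le> real (p + m) * fact (p + m - 1)" using step assms by (intro mult_mono) auto
  also have "\<dots> = fact (Suc p + m - 1)" using step fact_reduce[of "p + m", where 'a = real] by simp
  finally show ?case .
qed simp

lemma fact_mult_fact_less:
  assumes "2 \<le> p" "2 \<le> m"
  shows "fact p * fact m < (fact (p + m - 1) :: real)"
  using assms(1)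
proof (induction p rule: dec_induct)
  case base
  show ?case using assms(2) by (simp add: fact_numeral)
next
  case (step p)
  have "fact (Suc p) * fact m = real (Suc p) * (fact p * fact m)" by simp
  also have "\<dots> < real (p + m) * fact (p + m - 1)" using step assms by (intro mult_strict_mono) auto
  also have "\<dots> = fact (Suc p + m - 1)" using step fact_reduce[of "p + m", where 'a = real] by simp
  finally show ?case .
qed

context content_sequence
begin

abbreviation rb :: "nat \<Rightarrow> real" where
  "rb j \<equiv> of_int (b j)"

text \<open>An earlier neighbour might lie on the far side, with value \<open>b k + e\<close>. It
  then has by induction an earlier entry of value \<open>b k\<close>, and \<open>between\<close>,
  applied to that entry and \<open>k\<close>, supplies \<open>b k - e\<close>.\<close>

lemma toward_zero:
  assumes "e = 1 \<or> e = - 1" "1 \<le> k" "k \<le> n" "e * b k > 0"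
  shows "\<exists>j\<in>{1..<k}. b j = b k - e"
  using assms(2-4)
proof (induction k rule: less_induct)
  case (less k)
  then obtain j where j: "j \<in> {1..<k}" "b k = b j + 1 \<or> b k = b j - 1"
    using neighbour[of k] by force
  show ?case
  proof (cases "b j = b k - e")
    case True
    then show ?thesis using j(1) by blast
  next
    case False
    then have bj: "b j = b k + e" using j(2) assms(1) by auto
    have "e * b j > 0" using bj less.prems(3) assms(1) by auto
    then obtain i where i: "i \<in> {1..<j}" "b i = b j - e"
      using less.IH[of j] j(1) less.prems by auto
    have "\<exists>r. i < r \<and> r < k \<and> b r = b i + - e"
      using i bj j(1) less.prems assms(1) by (intro between) auto
    then show ?thesis using i bj by force
  qed
qed

text \<open>With no second box on the main diagonal the shape is a hook with arm \<open>p\<close>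
  and leg \<open>m\<close>. A repeated value \<open>x\<close> is impossible: the value one step
  closer to zero would occur before the first \<open>x\<close> and again between the two, against
  injectivity. So each new content extends the interval at one end. The last formula is product
  times sum of reciprocals.\<close>

lemma hook:
  assumes "Suc k \<le> n" "\<forall>j\<in>{2..Suc k}. b j \<noteq> 0"
  shows "\<exists>p m. p + m = k \<and> inj_on b {1..Suc k} \<and> b ` {1..Suc k} = {- int m..int p} \<and>
    shift_prod rb k = (-1) ^ m * fact p * fact m \<and>
    2 * shift_sum rb k = real p * (real p + 1) - real m * (real m + 1) \<and>
    shift_esym rb k = shift_prod rb k * (hsum p - hsum m)"
  using assms
proof (induction k)
  case 0
  then show ?case using b_1 by (auto simp: inj_on_def)
next
  case (Suc k)
  have "\<forall>j\<in>{2..Suc k}. b j \<noteq> 0" using Suc.prems(2) by auto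
  from Suc.IH[OF Suc_leD[OF Suc.prems(1)] this] obtain p m where pm: "p + m = k" "inj_on b {1..Suc k}" "b ` {1..Suc k} = {- int m..int p}"
    and pr: "shift_prod rb k = (-1) ^ m * fact p * fact m"
    and sm: "2 * shift_sum rb k = real p * (real p + 1) - real m * (real m + 1)"
    and es: "shift_esym rb k = shift_prod rb k * (hsum p - hsum m)" by blast
  define x where "x = b (Suc (Suc k))"
  have x0: "x \<noteq> 0" using Suc.prems by (simp add: x_def)
  define e where "e = sgn x"
  have e: "e = 1 \<or> e = - 1" "e * x > 0" using x0 by (auto simp: e_def sgn_if)
  have new: "x \<notin> b ` {1..Suc k}"
  proof
    assume "x \<in> b ` {1..Suc k}"
    then obtain i where i: "i \<in> {1..Suc k}" "b i = x" by auto
    have "\<exists>r. i < r \<and> r < Suc (Suc k) \<and> b r = b i + - e"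
      using i e Suc.prems by (intro between) (auto simp: x_def)
    then obtain r where r: "i < r" "r < Suc (Suc k)" "b r = x - e" using i by auto
    obtain j where j: "j \<in> {1..<i}" "b j = x - e"
      using toward_zero[OF e(1), of i] i e Suc.prems by auto
    have "r = j" using pm(2) r j i by (intro inj_onD[OF pm(2)]) auto
    then show False using r j by auto
  qed
  have "x - e \<in> b ` {1..Suc k}"
    using toward_zero[OF e(1), of "Suc (Suc k)"] e Suc.prems by (force simp: x_def)
  with new have cases: "x = int (Suc p) \<or> x = - int (Suc m)"
    using e unfolding pm(3) by auto
  have S: "{1..Suc (Suc k)} = insert (Suc (Suc k)) {1..Suc k}" by auto
  have inj: "inj_on b {1..Suc (Suc k)}"
    unfolding S using pm(2) new by (simp add: x_def)
  have img: "b ` {1..Suc (Suc k)} = insert x {- int m..int p}"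
    unfolding S using pm(3) by (simp add: x_def)
  have rb: "rb (k + 2) = of_int x" by (simp add: x_def)
  from cases show ?case
  proof
    assume xp: "x = int (Suc p)"
    show ?thesis
    proof (rule exI[of _ "Suc p"], rule exI[of _ m], intro conjI)
      show "b ` {1..Suc (Suc k)} = {- int m..int (Suc p)}" unfolding img xp by auto
      show "shift_esym rb (Suc k) = shift_prod rb (Suc k) * (hsum (Suc p) - hsum m)"
        using es rb xp by (simp add: hsum_Suc divide_simps) (simp add: algebra_simps)
    qed (use pm inj pr sm rb xp in \<open>auto simp: algebra_simps\<close>)
  next
    assume xm: "x = - int (Suc m)"
    show ?thesis
    proof (rule exI[of _ p], rule exI[of _ "Suc m"], intro conjI)
      show "b ` {1..Suc (Suc k)} = {- int (Suc m)..int p}" unfolding img xm by auto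
      show "shift_esym rb (Suc k) = shift_prod rb (Suc k) * (hsum p - hsum (Suc m))"
        using es rb xm by (simp add: hsum_Suc divide_simps) (simp add: algebra_simps)
      have rbm: "rb (k + 2) = - (1 + real m)" using rb xm by simp
      show "shift_prod rb (Suc k) = (-1) ^ Suc m * fact p * fact (Suc m)"
        unfolding shift_prod.simps pr rbm by (simp add: algebra_simps)
    qed (use pm inj sm rb xm in \<open>auto simp: algebra_simps\<close>)
  qed
qed

text \<open>A second zero kills the product, and in \<open>shift_esym\<close> only the term omitting
  this zero survives. Its size is estimated box by box, since at each step the contents can exceed
  their earlier range by at most one.\<close>

lemma nonhook:
  assumes "q \<in> {2..n}" "b q = 0"
  shows "shift_prod rb (n - 1) = 0" "\<bar>shift_esym rb (n - 1)\<bar> \<le> fact (n - 3)"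
proof -
  define P where "P q \<longleftrightarrow> q \<in> {2..n} \<and> b q = 0" for q
  have "P q" using assms by (simp add: P_def)
  then have "P (LEAST q. P q)" by (rule LeastI)
  define q where "q = (LEAST q. P q)"
  have "P q" using \<open>P (LEAST q. P q)\<close> by (simp add: q_def)
  moreover have least: "\<not> P j" if "j < q" for j using not_less_Least that by (auto simp: q_def)
  ultimately have q: "2 \<le> q" "q \<le> n" "b q = 0" by (auto simp: P_def)
  obtain k where k: "q = Suc (Suc k)" using q(1) by (metis Suc_le_D numeral_2_eq_2 le_Suc_ex plus_nat.simps(2) add_2_eq_Suc)
  have "b j \<noteq> 0" if "j \<in> {2..Suc k}" for j
    using least[of j] that q k by (auto simp: P_def)
  then have "\<forall>j\<in>{2..Suc k}. b j \<noteq> 0" by blast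
  moreover have "Suc k \<le> n" using q k by simp
  ultimately obtain p m where pm: "p + m = k" "b ` {1..Suc k} = {- int m..int p}"
    and pr: "shift_prod rb k = (-1) ^ m * fact p * fact m"
    using hook[of k] by blast
  \<comment> \<open>The zeros at positions \<open>1\<close> and \<open>q\<close> enclose both
    \<open>1\<close> and \<open>- 1\<close>, so arm and leg are nonempty when the second zero
    arrives.\<close>
  have "\<exists>r. 1 < r \<and> r < q \<and> b r = b 1 + d" if "\<bar>d\<bar> = 1" for d
    using q b_1 that by (intro between) auto
  then have "d \<in> b ` {1..Suc k}" if "\<bar>d\<bar> = 1" for d
    using b_1 k that by force
  from this[of 1] this[of "-1"] have "1 \<in> b ` {1..Suc k}" "- 1 \<in> b ` {1..Suc k}"
    by auto
  then have pm1: "1 \<le> p" "1 \<le> m" unfolding pm(2) by auto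
  \<comment> \<open>Here \<open>p\<close> and \<open>m\<close> are only bounds for the contents:
    each step raises one of them, even if its content is not new, so that the factorials absorb the
    new factor and \<open>p + m\<close> keeps pace with \<open>l\<close>.\<close>
  have "\<exists>p m. 1 \<le> p \<and> 1 \<le> m \<and> p + m + 1 = l \<and> (\<forall>j\<in>{1..Suc l}. - int m \<le> b j \<and> b j \<le> int p)
      \<and> shift_prod rb l = 0 \<and> \<bar>shift_esym rb l\<bar> \<le> fact p * fact m"
    if "Suc k \<le> l" "Suc l \<le> n" for l
    using that
  proof (induction l rule: dec_induct)
    case base
    have "- int m \<le> b j \<and> b j \<le> int p" if "j \<in> {1..Suc (Suc k)}" for j
    proof (cases "j = Suc (Suc k)")
      case False
      then have "b j \<in> b ` {1..Suc k}" using that by auto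
      then show ?thesis unfolding pm(2) by simp
    qed (use q k in simp)
    then show ?case
      using pm pm1 pr q k by - (rule exI[of _ p], rule exI[of _ m], auto simp: abs_mult)
  next
    case (step l)
    then obtain p m where pm: "1 \<le> p" "1 \<le> m" "p + m + 1 = l"
      and bd: "\<forall>j\<in>{1..Suc l}. - int m \<le> b j \<and> b j \<le> int p"
      and pr: "shift_prod rb l = 0" and es: "\<bar>shift_esym rb l\<bar> \<le> fact p * fact m" by auto
    define x where "x = b (Suc (Suc l))"
    have es': "\<bar>shift_esym rb (Suc l)\<bar> = \<bar>shift_esym rb l\<bar> * \<bar>of_int x\<bar>"
      using pr by (simp add: abs_mult x_def)
    have S: "{1..Suc (Suc l)} = insert (Suc (Suc l)) {1..Suc l}" by auto
    show ?case
    proof (cases "x < 0")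
      case True
      then obtain j where "j \<in> {1..<Suc (Suc l)}" "b j = x + 1"
        using toward_zero[of "-1" "Suc (Suc l)"] step by (auto simp: x_def)
      then have x: "- int (Suc m) \<le> x" using bd by force
      have "\<bar>shift_esym rb l\<bar> * \<bar>of_int x\<bar> \<le> (fact p * fact m) * real (Suc m)"
        using es x True by (intro mult_mono) auto
      also have "\<dots> = fact p * fact (Suc m)" by (simp add: algebra_simps)
      finally show ?thesis using pm pr bd True x es' unfolding S
        by - (rule exI[of _ p], rule exI[of _ "Suc m"], auto simp: x_def simp del: fact_Suc shift_esym.simps)
    next
      case False
      have x: "x \<le> int (Suc p)"
      proof (cases "x = 0")
        case False
        then obtain j where "j \<in> {1..<Suc (Suc l)}" "b j = x - 1"
          using toward_zero[of 1 "Suc (Suc l)"] step \<open>\<not> x < 0\<close> by (auto simp: x_def)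
        then show ?thesis using bd by force
      qed auto
      have "\<bar>shift_esym rb l\<bar> * \<bar>of_int x\<bar> \<le> (fact p * fact m) * real (Suc p)"
        using es x False by (intro mult_mono) auto
      also have "\<dots> = fact (Suc p) * fact m" by (simp add: algebra_simps)
      finally show ?thesis using pm pr bd False x es' unfolding S
        by - (rule exI[of _ "Suc p"], rule exI[of _ m], auto simp: x_def simp del: fact_Suc shift_esym.simps)
    qed
  qed
  moreover have "Suc k \<le> n - 1" "Suc (n - 1) \<le> n" using q k by auto
  ultimately obtain p m where *: "1 \<le> p" "1 \<le> m" "p + m + 1 = n - 1"
    "shift_prod rb (n - 1) = 0" "\<bar>shift_esym rb (n - 1)\<bar> \<le> fact p * fact m"
    by meson
  show "shift_prod rb (n - 1) = 0" by fact
  have "p + m - 1 = n - 3" using * by auto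
  then show "\<bar>shift_esym rb (n - 1)\<bar> \<le> fact (n - 3)"
    using fact_mult_fact_le[OF *(1,2)] *(5) by simp
qed

end

text \<open>
  On the hook with arm \<open>p\<close> and leg \<open>m\<close> the operator defined below acts as
  \<open>(-1)^m p! m! (hweight n (n - 1) + hweight n p - hweight n m)\<close>.
\<close>

definition hweight :: "nat \<Rightarrow> nat \<Rightarrow> real" where
  "hweight n p = real p * (real p + 1) / 2 - (real n - 1) * hsum p"

definition mu :: "nat \<Rightarrow> real" where
  "mu n = 2 * hweight n (n - 1) * fact (n - 2)"

definition eigenvalue :: "nat \<Rightarrow> (nat \<Rightarrow> real) \<Rightarrow> real" where
  "eigenvalue n x = hweight n (n - 1) * shift_prod x (n - 1)
     + (shift_sum x (n - 1) * shift_prod x (n - 1) - (real n - 1) * shift_esym x (n - 1))"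

text \<open>The constant is the value at \<open>n = 5\<close>, namely \<open>5/2 - 25/12\<close>;
  afterwards each step adds \<open>1/2\<close> and subtracts \<open>1/n\<close>. It leaves enough
  room for the shapes that are not hooks, because \<open>2 (n - 2) * 5/12\<close> exceeds
  \<open>1\<close>.\<close>

lemma half_minus_hsum:
  assumes "5 \<le> n"
  shows "real n / 2 - hsum (n - 1) \<ge> 5 / 12"
  using assms
proof (induction n rule: dec_induct)
  case base
  show ?case by (simp add: hsum_def eval_nat_numeral)
next
  case (step n)
  have "hsum n = hsum (n - 1) + 1 / real n" using step hsum_Suc[of "n - 1"] by simp
  moreover have "1 / real n \<le> 1 / 2" using step by (intro divide_left_mono) auto
  moreover have "real (Suc n) / 2 = real n / 2 + 1 / 2" by (simp add: field_simps)
  ultimately have "real (Suc n) / 2 - hsum n \<ge> 5 / 12" using step.IH by linarith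
  then show ?case by simp
qed

lemma hweight_top:
  assumes "5 \<le> n"
  shows "hweight n (n - 1) \<ge> (real n - 1) * (5 / 12)"
proof -
  have "hweight n (n - 1) = (real n - 1) * (real n / 2 - hsum (n - 1))"
    using assms by (simp add: hweight_def of_nat_diff field_simps)
  also have "\<dots> \<ge> (real n - 1) * (5 / 12)"
    using half_minus_hsum[OF assms] assms by (intro mult_left_mono) auto
  finally show ?thesis .
qed

lemma mu_pos: "5 \<le> n \<Longrightarrow> mu n > 0"
  unfolding mu_def by (intro mult_pos_pos less_le_trans[OF _ hweight_top]) auto

lemma hweight_0 [simp]: "hweight n 0 = 0"
  by (simp add: hweight_def)

text \<open>Decides the two hooks next to the extreme ones: for \<open>m = 1\<close> the weight in
  the eigenvalue doubles to give \<open>- mu n\<close>, for \<open>p = 1\<close> it cancels to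
  \<open>0\<close>.\<close>

lemma hweight_1: "5 \<le> n \<Longrightarrow> hweight n (n - 2) - hweight n 1 = hweight n (n - 1)"
  using hsum_Suc[of "n - 2"] 
  by (simp add: hweight_def hsum_def of_nat_diff Suc_diff_Suc numeral_2_eq_2 field_simps)

text \<open>With \<open>n = p + r + 2\<close> the two increments of \<open>hweight\<close> add up to
  \<open>(p + r + 2) (1 - (p + r + 1) / ((p + 1) (r + 1)))\<close>, and \<open>p + r + 1\<close> is
  at most \<open>(p + 1) (r + 1)\<close>.\<close>

lemma hweight_diff_mono:
  assumes "p < n - 1"
  shows "hweight n p - hweight n (n - 1 - p) \<le> hweight n (Suc p) - hweight n (n - 1 - Suc p)"
proof -
  define r where "r = n - 1 - Suc p"
  have r: "n - 1 - p = Suc r" "n = p + r + 2" using assms by (auto simp: r_def)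
  have "(real p + real r + 1) * (real p + real r + 2) \<le> ((real p + 1) * (real r + 1)) * (real p + real r + 2)"
    by (intro mult_right_mono) (auto simp: algebra_simps)
  moreover have "(real p + real r + 1) * (1 / (real p + 1) + 1 / (real r + 1))
      = (real p + real r + 1) * (real p + real r + 2) / ((real p + 1) * (real r + 1))"
    by (simp add: divide_simps)
  ultimately have "(real p + real r + 1) * (1 / (real p + 1) + 1 / (real r + 1)) \<le> real p + real r + 2"
    by (simp add: pos_divide_le_eq mult.commute)
  moreover have "hweight n (Suc p) - hweight n p = real p + 1 - (real p + real r + 1) * (1 / (real p + 1))"
    using r(2) by (simp add: hweight_def hsum_Suc field_simps)
  moreover have "hweight n (Suc r) - hweight n r = real r + 1 - (real p + real r + 1) * (1 / (real r + 1))"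
    using r(2) by (simp add: hweight_def hsum_Suc field_simps)
  ultimately show ?thesis unfolding r(1) r_def[symmetric] by (simp add: distrib_left)
qed

lemma hweight_diff_le:
  assumes "p \<le> n - 1"
  shows "hweight n p - hweight n (n - 1 - p) \<le> hweight n (n - 1)"
  using assms
proof (induction p rule: inc_induct)
  case (step p)
  then show ?case using hweight_diff_mono[of p n] by simp
qed simp

lemma abs_hweight_diff_le:
  assumes "p + m = n - 1"
  shows "\<bar>hweight n p - hweight n m\<bar> \<le> hweight n (n - 1)"
proof -
  have "n - 1 - p = m" "n - 1 - m = p" using assms by auto
  then show ?thesis using hweight_diff_le[of p n] hweight_diff_le[of m n] assms by auto
qed

text \<open>The first outcome is the only tableau with a single row; the second is the shape of the
  standard representation, \<open>j\<close> being the entry of the one box in the second row; all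
  other shapes fall under the third.\<close>

lemma (in content_sequence) eigenvalue_cases:
  assumes n5: "5 \<le> n"
  obtains "eigenvalue n rb = real (n - 1) * mu n" "\<And>k. k \<in> {1..n} \<Longrightarrow> b k = int k - 1"
  | j where "eigenvalue n rb = - mu n" "j \<in> {2..n}"
      "\<And>k. k \<in> {1..n} \<Longrightarrow> b k = (if k < j then int k - 1 else if k = j then - 1 else int k - 2)"
  | "\<bar>eigenvalue n rb\<bar> < mu n"
proof (cases "\<exists>q\<in>{2..n}. b q = 0")
  case True
  then obtain q where q: "q \<in> {2..n}" "b q = 0" by blast
  have f: "fact (n - 2) = real (n - 2) * fact (n - 3)"
    using n5 fact_reduce[of "n - 2", where 'a = real] by (simp add: numeral_3_eq_3)
  have "\<bar>eigenvalue n rb\<bar> = (real n - 1) * \<bar>shift_esym rb (n - 1)\<bar>"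
    using n5 nonhook(1)[OF q] by (simp add: eigenvalue_def abs_mult)
  also have "\<dots> \<le> (real n - 1) * fact (n - 3)"
    using nonhook(2)[OF q] n5 by (intro mult_left_mono) auto
  also have "\<dots> < (real n - 1) * (5 / 12) * (2 * real (n - 2)) * fact (n - 3)"
  proof -
    have "real (n - 2) \<ge> 3" using n5 by auto
    then have "1 < (5 / 12) * (2 * real (n - 2))" by simp
    then have "(real n - 1) * fact (n - 3) * 1 < (real n - 1) * fact (n - 3) * ((5 / 12) * (2 * real (n - 2)))"
      using n5 by (intro mult_strict_left_mono) auto
    then show ?thesis by (simp add: algebra_simps)
  qed
  also have "\<dots> \<le> hweight n (n - 1) * (2 * real (n - 2)) * fact (n - 3)"
    using hweight_top[OF n5] by (intro mult_right_mono) auto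
  also have "\<dots> = mu n" by (simp add: mu_def f)
  finally show ?thesis using that(3) by blast
next
  case False
  have hpos: "hweight n (n - 1) > 0"
    using hweight_top[OF n5] n5 by (intro less_le_trans[OF _ hweight_top[OF n5]]) auto
  obtain p m where pm: "p + m = n - 1" 
    and pr: "shift_prod rb (n - 1) = (-1) ^ m * fact p * fact m"
    and sm: "2 * shift_sum rb (n - 1) = real p * (real p + 1) - real m * (real m + 1)"
    and es: "shift_esym rb (n - 1) = shift_prod rb (n - 1) * (hsum p - hsum m)"
    and img: "b ` {1..n} = {- int m..int p}"
  proof -
    have "Suc (n - 1) = n" using n5 by simp
    then show ?thesis using hook[of "n - 1"] False that by (metis order_refl)
  qed
  have sm': "shift_sum rb (n - 1) = real p * (real p + 1) / 2 - real m * (real m + 1) / 2"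
    using sm by (simp add: field_simps)
  have ev: "eigenvalue n rb = shift_prod rb (n - 1) * (hweight n (n - 1) + (hweight n p - hweight n m))"
    unfolding eigenvalue_def es sm' hweight_def[of n p] hweight_def[of n m] by (simp add: field_simps)
  have abs_pr: "\<bar>shift_prod rb (n - 1)\<bar> = fact p * fact m" unfolding pr by (simp add: abs_mult)
  \<comment> \<open>Used for every initial segment: the set of contents at each stage determines the
    content added there.\<close>
  have state: "\<exists>p m. p + m + 1 = k \<and> inj_on b {1..k} \<and> b ` {1..k} = {- int m..int p}" if "k \<in> {1..n}" for k
  proof -
    have k: "Suc (k - 1) = k" using that by simp
    have "\<forall>j\<in>{2..k}. b j \<noteq> 0" "k \<le> n" using False that by auto
    then obtain p m where "p + m = k - 1" "inj_on b {1..k}" "b ` {1..k} = {- int m..int p}"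
      using hook[of "k - 1", unfolded k] by blast
    then show ?thesis using that by - (rule exI[of _ p], rule exI[of _ m], auto)
  qed
  have mu0: "mu n > 0" using hpos by (simp add: mu_def)
  consider "m = 0" | "m = 1" | "2 \<le> m" "2 \<le> p" | "p = 0" | "p = 1" by linarith
  then show ?thesis
  proof cases
    case 1
    then have p: "p = n - 1" using pm by simp
    have "eigenvalue n rb = real (n - 1) * mu n"
      using 1 p ev pr n5 fact_reduce[of "n - 1", where 'a = real] by (simp add: mu_def numeral_2_eq_2)
    moreover have "b k = int k - 1" if k: "k \<in> {1..n}" for k
    proof -
      obtain p' m' where s: "p' + m' + 1 = k" "b ` {1..k} = {- int m'..int p'}"
        using state[OF k] by blast
      have "{- int m'..int p'} \<subseteq> {0..int p}" using s(2) img 1 k by fastforce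
      then have m': "m' = 0" by auto
      have le: "b i \<le> int k - 1" if "i \<in> {1..k}" for i
      proof -
        have "b i \<in> {- int m'..int p'}" using s(2) that by blast
        then show ?thesis using s(1) m' by auto
      qed
      show ?thesis
      proof (rule ccontr)
        assume "b k \<noteq> int k - 1"
        have "int k - 1 \<in> b ` {1..k}" using s m' by auto
        then obtain i where i: "i \<in> {1..k}" "b i = int k - 1" by force
        with \<open>b k \<noteq> int k - 1\<close> have ik: "i \<in> {1..k - 1}" "k - 1 \<in> {1..n}" using k by (auto simp: le_less)
        obtain p'' m'' where t: "p'' + m'' + 1 = k - 1" "b ` {1..k - 1} = {- int m''..int p''}"
          using state[OF ik(2)] by blast
        have "b i \<in> {- int m''..int p''}" using t(2) ik by blast
        then show False using t(1) i(2) by auto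
      qed
    qed
    ultimately show ?thesis by (rule that(1))
  next
    case 2
    then have p: "p = n - 2" using pm by simp
    have "eigenvalue n rb = - mu n"
      using 2 p ev pr hweight_1[OF n5] by (simp add: mu_def)
    moreover 
    have "- 1 \<in> b ` {1..n}" using img 2 p by auto
    then obtain j where j: "j \<in> {1..n}" "b j = - 1" by force
    have "j \<noteq> 1" using b_1 j by auto
    then have "j \<in> {2..n}" using j by auto
    moreover have "b k = (if k < j then int k - 1 else if k = j then - 1 else int k - 2)" if k: "k \<in> {1..n}" for k
    proof -
      have st: "b ` {1..k} = (if k < j then {0..int k - 1} else {-1..int k - 2})" if k: "k \<in> {1..n}" for k
      proof -
        obtain p' m' where s: "p' + m' + 1 = k" "b ` {1..k} = {- int m'..int p'}"
          using state[OF k] by blast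
        have "{- int m'..int p'} \<subseteq> {-1..int p}" using s(2) img 2 k by fastforce
        then have m': "m' \<le> 1" by auto
        have "inj_on b {1..n}" using state[of n] n5 by auto
        then have "i = j" if "i \<in> {1..k}" "b i = - 1" for i
          using inj_onD[of b "{1..n}" i j] that j k by auto
        then have "- 1 \<in> b ` {1..k} \<longleftrightarrow> j \<le> k" 
          using j(1) j(2)[symmetric] by force
        then have "m' = (if k < j then 0 else 1)" unfolding s(2) using m' by auto
        then show ?thesis using s by (auto split: if_splits)
      qed
      show ?thesis
      proof (cases "k = 1")
        case True
        then show ?thesis using b_1 \<open>j \<in> {2..n}\<close> by auto
      next
        case False
        have k': "k - 1 \<in> {1..n}" using False k by auto
        have inj: "inj_on b {1..k}" using state[OF k] by blast
        have "b k \<in> b ` {1..k}" using k by auto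
        moreover have "b k \<notin> b ` {1..k - 1}"
        proof
          assume "b k \<in> b ` {1..k - 1}"
          then obtain i where i: "i \<in> {1..k - 1}" "b i = b k" by force
          then have "i \<in> {1..k}" "k \<in> {1..k}" "i \<noteq> k" by auto
          then show False using inj_onD[OF inj i(2)] by blast
        qed
        ultimately show ?thesis
          using st[OF k] st[OF k'] j(2) k by (auto split: if_splits)
      qed
    qed
    ultimately show ?thesis by (rule that(2))
  next
    case 3
    have "\<bar>eigenvalue n rb\<bar> = fact p * fact m * \<bar>hweight n (n - 1) + (hweight n p - hweight n m)\<bar>"
      unfolding ev abs_mult abs_pr ..
    also have "\<dots> \<le> fact p * fact m * (2 * hweight n (n - 1))"
      using abs_hweight_diff_le[OF pm] by (intro mult_left_mono) auto
    also have "\<dots> < fact (n - 2) * (2 * hweight n (n - 1))"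
    proof (intro mult_strict_right_mono)
      have "p + m - 1 = n - 2" using pm by simp
      then show "fact p * fact m < (fact (n - 2) :: real)" using fact_mult_fact_less[OF 3(2,1)] by simp
    qed (use hpos in auto)
    also have "\<dots> = mu n" by (simp add: mu_def)
    finally show ?thesis by (rule that(3))
  next
    case 4
    \<comment> \<open>The sign character: the bracket in \<open>ev\<close> is
      \<open>hweight n (n - 1) - hweight n (n - 1)\<close>.\<close>
    then have "eigenvalue n rb = 0" using pm by (simp add: ev)
    then show ?thesis using mu0 that(3) by simp
  next
    case 5
    \<comment> \<open>The standard representation multiplied by the sign.\<close>
    then have m: "m = n - 2" using pm by simp
    have "eigenvalue n rb = 0" using 5 m hweight_1[OF n5] by (simp add: ev)
    then show ?thesis using mu0 that(3) by simp
  qed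
qed

section \<open>The weighted adjacency operator\<close>

primrec jm_prod :: "nat \<Rightarrow> perm_fun \<Rightarrow> perm_fun" where
  "jm_prod 0 f = f"
| "jm_prod (Suc k) f = jm_prod k (jm (k + 2) f)"

primrec jm_esym :: "nat \<Rightarrow> perm_fun \<Rightarrow> perm_fun" where
  "jm_esym 0 f = 0"
| "jm_esym (Suc k) f = jm_esym k (jm (k + 2) f) + jm_prod k f"

primrec jm_sum :: "nat \<Rightarrow> perm_fun \<Rightarrow> perm_fun" where
  "jm_sum 0 f = 0"
| "jm_sum (Suc k) f = jm_sum k f + jm (k + 2) f"

text \<open>
  The product of the Jucys--Murphy elements is the sum of all \<open>n\<close>-cycles, its product with their
  sum is the sum of all permutations with two cycles, of lengths \<open>a\<close> and \<open>b\<close>, weighted by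
  \<open>a b\<close>, and \<open>jm_esym\<close> gives the unweighted sum. Since \<open>a b - (n - 1) = (a - 1) (b - 1)\<close>, the
  combination in parentheses is supported on derangements. Its parity is opposite to that of the
  \<open>n\<close>-cycles, and the factor \<open>hweight n (n - 1)\<close> balances the two parts so that the sign
  character has eigenvalue \<open>0\<close>.
\<close>

definition hoffman_op :: "nat \<Rightarrow> perm_fun \<Rightarrow> perm_fun" where
  "hoffman_op n f = fscale (of_real (hweight n (n - 1))) (jm_prod (n - 1) f)
     + (jm_sum (n - 1) (jm_prod (n - 1) f) - fscale (of_real (real n - 1)) (jm_esym (n - 1) f))"

lemma linear_opI:
  assumes "\<And>x y. T (x + y) = T x + T y" "\<And>c x. T (fscale c x) = fscale c (T x)"
  shows "fv.linear_op T"
  using assms by (simp add: fv.linear_op_def)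

lemmas jm_linear = fv.linear_op_add[OF linear_jm] fv.linear_op_scale[OF linear_jm]
  fv.linear_op_diff[OF linear_jm] fv.linear_op_zero[OF linear_jm]

lemma linear_jm_prod: "fv.linear_op (jm_prod k)"
proof (induction k)
  case (Suc k)
  note l = fv.linear_op_add[OF Suc] fv.linear_op_scale[OF Suc]
  show ?case by (rule linear_opI) (simp_all only: jm_prod.simps l jm_linear)
qed (rule linear_opI, simp_all only: jm_prod.simps)

lemma linear_jm_esym: "fv.linear_op (jm_esym k)"
proof (induction k)
  case (Suc k)
  note l = fv.linear_op_add[OF Suc] fv.linear_op_scale[OF Suc]
    fv.linear_op_add[OF linear_jm_prod] fv.linear_op_scale[OF linear_jm_prod]
  show ?case
    by (rule linear_opI) (simp_all only: jm_esym.simps l jm_linear fv.scale_right_distrib ac_simps)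
qed (rule linear_opI, simp_all only: jm_esym.simps add_0 fv.scale_zero_right)

lemma linear_jm_sum: "fv.linear_op (jm_sum k)"
proof (induction k)
  case (Suc k)
  note l = fv.linear_op_add[OF Suc] fv.linear_op_scale[OF Suc]
  show ?case
    by (rule linear_opI) (simp_all only: jm_sum.simps l jm_linear fv.scale_right_distrib ac_simps)
qed (rule linear_opI, simp_all only: jm_sum.simps add_0 fv.scale_zero_right)

lemmas jm_prod_linear = fv.linear_op_add[OF linear_jm_prod] fv.linear_op_scale[OF linear_jm_prod]
  fv.linear_op_diff[OF linear_jm_prod]
lemmas jm_esym_linear = fv.linear_op_add[OF linear_jm_esym] fv.linear_op_scale[OF linear_jm_esym]
lemmas jm_sum_linear = fv.linear_op_add[OF linear_jm_sum] fv.linear_op_scale[OF linear_jm_sum]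

lemma linear_hoffman_op: "fv.linear_op (hoffman_op n)"
  by (rule linear_opI)
     (simp_all only: hoffman_op_def jm_prod_linear jm_esym_linear jm_sum_linear,
      simp_all add: fun_eq_iff algebra_simps)

lemma commutes_jm_polys:
  assumes X: "fv.linear_op X" and "\<And>j f. j \<in> {2..Suc k} \<Longrightarrow> X (jm j f) = jm j (X f)"
  shows "X (jm_prod k f) = jm_prod k (X f)" "X (jm_esym k f) = jm_esym k (X f)" "X (jm_sum k f) = jm_sum k (X f)"
proof -
  have "X (jm_prod k f) = jm_prod k (X f) \<and> X (jm_esym k f) = jm_esym k (X f) \<and> X (jm_sum k f) = jm_sum k (X f)" for f
    using assms(2)
  proof (induction k arbitrary: f)
    case 0
    show ?case by (simp only: jm_prod.simps jm_esym.simps jm_sum.simps fv.linear_op_zero[OF X])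
  next
    case (Suc k)
    have 1: "X (jm (k + 2) f) = jm (k + 2) (X f)" for f by (rule Suc.prems) simp
    have IH: "X (jm_prod k f) = jm_prod k (X f)" "X (jm_esym k f) = jm_esym k (X f)" "X (jm_sum k f) = jm_sum k (X f)" for f
      using Suc.IH Suc.prems by auto
    show ?case
      by (simp only: jm_prod.simps jm_esym.simps jm_sum.simps 1 IH fv.linear_op_add[OF X])
  qed
  then show "X (jm_prod k f) = jm_prod k (X f)" "X (jm_esym k f) = jm_esym k (X f)" "X (jm_sum k f) = jm_sum k (X f)"
    by blast+
qed

lemmas jm_jm_polys = commutes_jm_polys[OF linear_jm jm_commute]

lemma jm_hoffman_op: "jm j (hoffman_op n f) = hoffman_op n (jm j f)"
  by (simp only: hoffman_op_def jm_linear jm_jm_polys)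

section \<open>Centrality and self-adjointness of the operator, and its eigenvalues\<close>

context
  fixes k :: nat
  assumes k: "1 \<le> k"
begin

lemma adj_jm_sum2: "adj k (jm k f + jm (Suc k) f) = jm k (adj k f) + jm (Suc k) (adj k f)"
  using adj_jm[OF k, of f] jm_adj[OF k, of f] by (simp add: fv.linear_op_add[OF linear_rtrans])

lemma adj_jm_prod2: "adj k (jm k (jm (Suc k) f)) = jm k (jm (Suc k) (adj k f))"
proof -
  have "adj k (jm k (jm (Suc k) f)) = jm (Suc k) (adj k (jm (Suc k) f)) - jm (Suc k) f"
    by (rule adj_jm[OF k])
  also have "\<dots> = jm (Suc k) (jm k (adj k f))" using jm_adj[OF k, of f] by (simp add: jm_linear)
  finally show ?thesis by (simp add: jm_commute)
qed

end

text \<open>An adjacent transposition commutes with the sum and the product of the two Jucys--Murphy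
  operators it touches, and with all others. So once these two are the last variables, each
  polynomial is rewritten through their sum and product, e.g.
  \<open>e(.., x, y) = e(..) x y + prod(..) (x + y)\<close>.\<close>

lemma adj_jm_polys:
  assumes "1 \<le> i" "i \<le> k"
  shows "adj i (jm_prod k f) = jm_prod k (adj i f)" "adj i (jm_esym k f) = jm_esym k (adj i f)" "adj i (jm_sum k f) = jm_sum k (adj i f)"
proof -
  note lin = fv.linear_op_add[OF linear_rtrans]
  have "adj i (jm_prod k f) = jm_prod k (adj i f) \<and> adj i (jm_esym k f) = jm_esym k (adj i f)
     \<and> adj i (jm_sum k f) = jm_sum k (adj i f)" for f
    using assms(2)
  proof (induction k arbitrary: f)
    case 0
    then show ?case using assms(1) by simp
  next
    case (Suc k)
    show ?case
    proof (cases "i = Suc k")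
      case False
      then have ik: "i \<le> k" using Suc.prems by simp
      note IH = conjunct1[OF Suc.IH[OF ik]] conjunct1[OF conjunct2[OF Suc.IH[OF ik]]]
        conjunct2[OF conjunct2[OF Suc.IH[OF ik]]]
      have 1: "adj i (jm (k + 2) f) = jm (k + 2) (adj i f)" for f
        using ik assms by (intro adj_jm_commute) auto
      show ?thesis
        by (simp only: jm_prod.simps jm_esym.simps jm_sum.simps 1 IH lin)
    next
      case i: True
      show ?thesis
      proof (cases k)
        case 0
        \<comment> \<open>The variable \<open>x 1\<close> is absent from the polynomials,
          consistently with \<open>jm 1 = 0\<close>.\<close>
        have "adj 1 (jm 2 f) = jm 2 (adj 1 f)"
          using adj_jm_sum2[of 1 f] by (simp add: numeral_2_eq_2)
        then show ?thesis using i 0 by (simp add: numeral_2_eq_2 fv.linear_op_zero[OF linear_rtrans] lin)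
      next
        case (Suc l)
        have "i \<ge> 1" "i = l + 2" "Suc i = k + 2" using i Suc by auto
        have c: "adj i (jm j f) = jm j (adj i f)" if "j \<in> {2..Suc l}" for j f
          using that i Suc by (intro adj_jm_commute) auto
        note 1 = commutes_jm_polys[OF linear_rtrans c]
        have 2: "adj i (jm (l + 2) (jm (k + 2) f)) = jm (l + 2) (jm (k + 2) (adj i f))" for f
          using adj_jm_prod2[OF \<open>i \<ge> 1\<close>, of f] i Suc by simp
        have 3: "adj i (jm (l + 2) f + jm (k + 2) f) = jm (l + 2) (adj i f) + jm (k + 2) (adj i f)" for f
          using adj_jm_sum2[OF \<open>i \<ge> 1\<close>, of f] i Suc by simp
        have e: "jm_esym (Suc k) f = jm_esym l (jm (l + 2) (jm (k + 2) f)) + jm_prod l (jm (l + 2) f + jm (k + 2) f)" for f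
          by (simp only: Suc jm_esym.simps jm_prod.simps jm_prod_linear ac_simps)
        have s: "jm_sum (Suc k) f = jm_sum l f + (jm (l + 2) f + jm (k + 2) f)" for f
          by (simp only: Suc jm_sum.simps ac_simps)
        have p: "jm_prod (Suc k) f = jm_prod l (jm (l + 2) (jm (k + 2) f))" for f
          by (simp only: Suc jm_prod.simps)
        show ?thesis unfolding e s p by (simp only: lin 1 2 3[unfolded lin])
      qed
    qed
  qed
  then show "adj i (jm_prod k f) = jm_prod k (adj i f)" "adj i (jm_esym k f) = jm_esym k (adj i f)"
    "adj i (jm_sum k f) = jm_sum k (adj i f)" by blast+
qed

lemma adj_hoffman_op:
  assumes "1 \<le> i" "i < n"
  shows "adj i (hoffman_op n f) = hoffman_op n (adj i f)"
proof -
  have "i \<le> n - 1" using assms by simp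
  note 1 = adj_jm_polys[OF assms(1) this]
  show ?thesis
    by (simp only: hoffman_op_def 1 fv.linear_op_add[OF linear_rtrans]
      fv.linear_op_diff[OF linear_rtrans] fv.linear_op_scale[OF linear_rtrans])
qed

text \<open>Centrality in the form in which it is applied: \<open>(m n)\<close>, a product of
  adjacent transpositions, carries an arbitrary position \<open>m\<close> to the last one.\<close>

lemma rtrans_hoffman_op:
  assumes "1 \<le> m" "m \<le> n"
  shows "rtrans (transpose m n) (hoffman_op n f) = hoffman_op n (rtrans (transpose m n) f)"
  using assms(2,1)
proof (induction m arbitrary: f rule: inc_induct)
  case base
  show ?case by (simp only: transpose_same rtrans_id)
next
  case (step m)
  show ?case
  proof (cases "n = Suc m")
    case True
    then show ?thesis using adj_hoffman_op[of m n f] step by simp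
  next
    case False
    have "transpose m n = transpose m (Suc m) \<circ> (transpose (Suc m) n \<circ> transpose m (Suc m))"
      using step.hyps False by (auto simp: fun_eq_iff transpose_def)
    then have e: "rtrans (transpose m n) f = adj m (rtrans (transpose (Suc m) n) (adj m f))" for f
      by (simp add: rtrans_rtrans)
    show ?thesis unfolding e using step by (simp add: adj_hoffman_op)
  qed
qed

lemma self_adjoint_jm_polys:
  assumes "Suc k \<le> n"
  shows "self_adjoint n (jm_prod k)" "self_adjoint n (jm_esym k)" "self_adjoint n (jm_sum k)"
proof -
  have "inner n (jm_prod k f) g = inner n f (jm_prod k g) \<and> inner n (jm_esym k f) g = inner n f (jm_esym k g)
     \<and> inner n (jm_sum k f) g = inner n f (jm_sum k g)" for f g
    using assms
  proof (induction k arbitrary: f g)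
    case (Suc k)
    then have IH: "inner n (jm_prod k f) g = inner n f (jm_prod k g)" "inner n (jm_esym k f) g = inner n f (jm_esym k g)"
     "inner n (jm_sum k f) g = inner n f (jm_sum k g)" for f g by auto
    have j: "inner n (jm (k + 2) f) g = inner n f (jm (k + 2) g)" for f g
      using Suc.prems by (intro inner_jm) auto
    show ?case
      by (simp only: jm_prod.simps jm_esym.simps jm_sum.simps inner_add_left inner_add_right IH j jm_jm_polys)
  qed (simp add: inner_zero_left inner_zero_right)
  then show "self_adjoint n (jm_prod k)" "self_adjoint n (jm_esym k)" "self_adjoint n (jm_sum k)"
    by (auto simp: self_adjoint_def)
qed

lemma self_adjoint_hoffman_op:
  assumes "1 \<le> n"
  shows "self_adjoint n (hoffman_op n)"
proof -
  have n: "Suc (n - 1) \<le> n" using assms by simp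
  note sa = self_adjoint_jm_polys[OF n, unfolded self_adjoint_def, rule_format]
  have c: "jm_sum (n - 1) (jm_prod (n - 1) f) = jm_prod (n - 1) (jm_sum (n - 1) f)" for f
    by (rule commutes_jm_polys(1)[OF linear_jm_sum]) (simp add: jm_jm_polys)
  show ?thesis
    unfolding self_adjoint_def hoffman_op_def inner_add_left inner_add_right inner_diff_left inner_diff_right
      inner_scale_left inner_scale_right sa c
    by simp
qed

lemma hoffman_op_perm_funs:
  assumes "1 \<le> n" "f \<in> perm_funs n"
  shows "hoffman_op n f \<in> perm_funs n"
proof -
  have "jm_prod k f \<in> perm_funs n \<and> jm_esym k f \<in> perm_funs n \<and> jm_sum k f \<in> perm_funs n"
    if "Suc k \<le> n" "f \<in> perm_funs n" for k f
    using that
  proof (induction k arbitrary: f)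
    case 0
    then show ?case by (simp only: jm_prod.simps jm_esym.simps jm_sum.simps fv.subspace_0[OF subspace_perm_funs] simp_thms)
  next
    case (Suc k)
    have j: "jm (k + 2) f \<in> perm_funs n" using Suc.prems by (intro jm_perm_funs) auto
    show ?case using Suc j by (auto intro!: fv.subspace_add subspace_perm_funs simp del: plus_fun_apply)
  qed
  then have *: "jm_prod (n - 1) f \<in> perm_funs n \<and> jm_esym (n - 1) f \<in> perm_funs n \<and> jm_sum (n - 1) f \<in> perm_funs n"
    if "f \<in> perm_funs n" for f using assms(1) that by simp
  show ?thesis unfolding hoffman_op_def using * assms(2)
    by (intro fv.subspace_add fv.subspace_diff fv.subspace_scale subspace_perm_funs) auto
qed

lemma jm_polys_eigen:
  assumes "\<And>j. j \<in> {2..Suc k} \<Longrightarrow> jm j v = fscale (of_real (x j)) v"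
  shows "jm_prod k v = fscale (of_real (shift_prod x k)) v \<and> jm_esym k v = fscale (of_real (shift_esym x k)) v
    \<and> jm_sum k v = fscale (of_real (shift_sum x k)) v"
  using assms
proof (induction k)
  case 0
  show ?case by (simp add: fun_eq_iff)
next
  case (Suc k)
  have j: "jm (k + 2) v = fscale (of_real (x (k + 2))) v" by (rule Suc.prems) simp
  have IH: "jm_prod k v = fscale (of_real (shift_prod x k)) v" "jm_esym k v = fscale (of_real (shift_esym x k)) v"
    "jm_sum k v = fscale (of_real (shift_sum x k)) v" using Suc by auto
  show ?case
    unfolding jm_prod.simps jm_esym.simps jm_sum.simps j jm_prod_linear jm_esym_linear IH
      shift_prod.simps shift_esym.simps shift_sum.simps
    by (simp add: fun_eq_iff algebra_simps)
qed

lemma hoffman_op_eigen: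
  assumes "\<And>j. j \<in> {2..n} \<Longrightarrow> jm j v = fscale (of_real (x j)) v" "1 \<le> n"
  shows "hoffman_op n v = fscale (of_real (eigenvalue n x)) v"
proof -
  have "\<And>j. j \<in> {2..Suc (n - 1)} \<Longrightarrow> jm j v = fscale (of_real (x j)) v" using assms by simp
  note e = jm_polys_eigen[OF this, rule_format]
  have e': "jm_prod (n - 1) v = fscale (of_real (shift_prod x (n - 1))) v"
    "jm_esym (n - 1) v = fscale (of_real (shift_esym x (n - 1))) v"
    "jm_sum (n - 1) v = fscale (of_real (shift_sum x (n - 1))) v" using e by auto
  show ?thesis unfolding hoffman_op_def e' jm_sum_linear eigenvalue_def
    by (simp add: fun_eq_iff algebra_simps)
qed

text \<open>Bijectivity is all that is asked of the arguments: it gives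
  \<open>\<sigma> i \<noteq> \<sigma> n\<close> and survives composition with
  transpositions.\<close>

definition vanishing :: "nat \<Rightarrow> nat \<Rightarrow> perm_fun set" where
  "vanishing n c = {f. \<forall>\<sigma>. bij \<sigma> \<longrightarrow> \<sigma> n = c \<longrightarrow> f \<sigma> = 0}"

lemma subspace_vanishing: "fv.subspace (vanishing n c)"
  by (auto simp: fv.subspace_def vanishing_def)

lemma jm_vanishing: "j < n \<Longrightarrow> f \<in> vanishing n c \<Longrightarrow> jm j f \<in> vanishing n c"
  by (auto simp: vanishing_def jm_apply bij_comp intro!: sum.neutral)

lemma jm_polys_vanishing:
  assumes "Suc k < n" "f \<in> vanishing n c"
  shows "jm_prod k f \<in> vanishing n c \<and> jm_esym k f \<in> vanishing n c \<and> jm_sum k f \<in> vanishing n c"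
  using assms
proof (induction k arbitrary: f)
  case 0
  then show ?case by (simp only: jm_prod.simps jm_esym.simps jm_sum.simps fv.subspace_0[OF subspace_vanishing] simp_thms)
next
  case (Suc k)
  have j: "jm (k + 2) f \<in> vanishing n c" using Suc.prems by (intro jm_vanishing) auto
  show ?case using Suc j by (auto intro!: fv.subspace_add subspace_vanishing simp del: plus_fun_apply)
qed

text \<open>
  Because the operator is central, it suffices to consider the fixed point \<open>n\<close>. Every term
  with exactly one factor \<open>jm n\<close> moves \<open>n\<close>, and \<open>jm n \<circ> jm n\<close> contributes \<open>n - 1\<close> times the
  identity, which cancels against \<open>jm_esym\<close>.
\<close>

lemma hoffman_op_vanishing:
  assumes n: "2 \<le> n" and f: "\<And>\<rho>. \<rho> n \<noteq> c \<Longrightarrow> f \<rho> = 0"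
  shows "hoffman_op n f \<in> vanishing n c"
proof -
  obtain k where k: "n = k + 2" using n by (metis add.commute le_Suc_ex)
  have n1: "n - 1 = Suc k" using k by simp
  let ?V = "vanishing n c"
  have 0: "f (\<sigma> \<circ> transpose i n) = 0" if "bij \<sigma>" "\<sigma> n = c" "i < n" for \<sigma> i
  proof -
    have "\<sigma> i \<noteq> \<sigma> n" using that by (auto simp: bij_def inj_eq)
    then show ?thesis using that by (intro f) simp
  qed
  have 1: "jm n f \<in> ?V" by (auto simp: vanishing_def jm_apply 0 intro!: sum.neutral)
  have 2: "jm n (jm n f) - fscale (of_real (real n - 1)) f \<in> ?V"
    unfolding vanishing_def
  proof (intro CollectI allI impI)
    fix \<sigma> :: "nat \<Rightarrow> nat" assume s: "bij \<sigma>" "\<sigma> n = c"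
    have "f (\<sigma> \<circ> transpose i n \<circ> transpose j n) = (if j = i then f \<sigma> else 0)"
      if "i < n" "j < n" for i j
    proof (cases "j = i")
      case True
      then show ?thesis by (simp add: comp_assoc)
    next
      case False
      have "\<sigma> j \<noteq> \<sigma> n" using s that by (auto simp: bij_def inj_eq)
      then show ?thesis using that s False by (simp add: f)
    qed
    then have "jm n (jm n f) \<sigma> = (\<Sum>i=1..<n. \<Sum>j=1..<n. if j = i then f \<sigma> else 0)"
      unfolding jm_apply by (intro sum.cong refl) simp
    also have "\<dots> = (\<Sum>i=1..<n. f \<sigma>)" by (intro sum.cong) auto
    also have "\<dots> = of_real (real n - 1) * f \<sigma>" using n by (simp add: of_nat_diff)
    finally show "(jm n (jm n f) - fscale (of_real (real n - 1)) f) \<sigma> = 0" by simp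
  qed
  have kn: "Suc k < n" using k by simp
  have 3: "jm_prod k (jm n f) \<in> ?V" "jm_esym k (jm n f) \<in> ?V" "jm_sum k (jm_prod k (jm n f)) \<in> ?V"
    "jm_prod k (jm n (jm n f) - fscale (of_real (real n - 1)) f) \<in> ?V"
    using jm_polys_vanishing[OF kn] 1 2 by auto
  have "hoffman_op n f = fscale (of_real (hweight n (n - 1))) (jm_prod k (jm n f))
     + (jm_sum k (jm_prod k (jm n f)) + jm_prod k (jm n (jm n f) - fscale (of_real (real n - 1)) f)
        - fscale (of_real (real n - 1)) (jm_esym k (jm n f)))"
    unfolding hoffman_op_def n1 jm_prod.simps jm_esym.simps jm_sum.simps k[symmetric] jm_prod_linear jm_jm_polys
    by (simp add: fun_eq_iff algebra_simps)
  also have "\<dots> \<in> ?V" using 3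
    by (intro fv.subspace_add fv.subspace_diff fv.subspace_scale subspace_vanishing)
  finally show ?thesis .
qed

text \<open>The matrix entry at \<open>\<sigma>\<close>, \<open>\<tau>\<close> is zero when they
  agree somewhere. Centrality moves the agreement from \<open>m\<close> to \<open>n\<close>, where
  \<open>hoffman_op_vanishing\<close> applies with \<open>c = \<tau> m\<close>.\<close>

lemma hoffman_op_delta_eq_0:
  assumes "2 \<le> n" "\<sigma> \<in> sym_grp n" "\<tau> \<in> sym_grp n" "m \<in> {1..n}" "\<sigma> m = \<tau> m"
  shows "hoffman_op n (delta \<tau>) \<sigma> = 0"
proof -
  let ?g = "transpose m n"
  have d: "rtrans ?g (delta \<tau>) = delta (\<tau> \<circ> ?g)"
  proof
    fix \<rho>
    have "\<rho> \<circ> ?g = \<tau> \<longleftrightarrow> \<rho> = \<tau> \<circ> ?g" by (auto simp: comp_assoc)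
    then show "rtrans ?g (delta \<tau>) \<rho> = delta (\<tau> \<circ> ?g) \<rho>" by (simp add: delta_def rtrans_apply)
  qed
  have "hoffman_op n (delta (\<tau> \<circ> ?g)) \<in> vanishing n (\<tau> m)"
    using assms(1) by (intro hoffman_op_vanishing) (auto simp: delta_def)
  moreover have "bij (\<sigma> \<circ> ?g)" using assms(2) by (auto simp: sym_grp_def bij_comp permutes_bij)
  ultimately have "hoffman_op n (delta (\<tau> \<circ> ?g)) (\<sigma> \<circ> ?g) = 0"
    using assms(5) by (simp add: vanishing_def)
  moreover have "rtrans ?g (hoffman_op n (delta \<tau>)) = hoffman_op n (delta (\<tau> \<circ> ?g))"
    using assms(4) by (subst rtrans_hoffman_op) (auto simp: d)
  ultimately have "rtrans ?g (hoffman_op n (delta \<tau>)) (\<sigma> \<circ> ?g) = 0" by simp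
  then show ?thesis by (simp add: rtrans_apply comp_assoc)
qed

section \<open>The quadratic form on functions of mean zero\<close>

definition linear_funs :: "nat \<Rightarrow> perm_fun set" where
  "linear_funs n = {f \<in> perm_funs n. \<exists>a. \<forall>\<sigma>\<in>sym_grp n. f \<sigma> = (\<Sum>i=1..n. a i (\<sigma> i))}"

lemma linear_funsI:
  assumes "f \<in> perm_funs n" "\<And>\<sigma>. \<sigma> \<in> sym_grp n \<Longrightarrow> f \<sigma> = (\<Sum>i=1..n. a i (\<sigma> i))"
  shows "f \<in> linear_funs n"
  using assms by (auto simp: linear_funs_def)

lemma subspace_linear_funs: "fv.subspace (linear_funs n)"
proof (rule fv.subspaceI)
  show "0 \<in> linear_funs n"
    using fv.subspace_0[OF subspace_perm_funs, of n] unfolding linear_funs_def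
    by (auto intro!: exI[of _ "\<lambda>_ _. 0"])
next
  fix f g assume "f \<in> linear_funs n" "g \<in> linear_funs n"
  then obtain a a' where "\<forall>\<sigma>\<in>sym_grp n. f \<sigma> = (\<Sum>i=1..n. a i (\<sigma> i))" "\<forall>\<sigma>\<in>sym_grp n. g \<sigma> = (\<Sum>i=1..n. a' i (\<sigma> i))"
    and fg: "f \<in> perm_funs n" "g \<in> perm_funs n"
    by (auto simp: linear_funs_def)
  then show "f + g \<in> linear_funs n"
    by (intro linear_funsI[where a = "\<lambda>i j. a i j + a' i j"] fv.subspace_add[OF subspace_perm_funs])
       (auto simp: sum.distrib)
next
  fix c f assume "f \<in> linear_funs n"
  then obtain a where "\<forall>\<sigma>\<in>sym_grp n. f \<sigma> = (\<Sum>i=1..n. a i (\<sigma> i))"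
    and f: "f \<in> perm_funs n"
    by (auto simp: linear_funs_def)
  then show "fscale c f \<in> linear_funs n"
    by (intro linear_funsI[where a = "\<lambda>i j. c * a i j"] fv.subspace_scale[OF subspace_perm_funs])
       (auto simp: sum_distrib_left)
qed

lemma rtrans_linear_funs:
  assumes "f \<in> linear_funs n" "p \<in> {1..n}" "q \<in> {1..n}"
  shows "rtrans (transpose p q) f \<in> linear_funs n"
proof -
  let ?t = "transpose p q"
  have t: "?t \<in> sym_grp n" using assms by (intro transpose_in_sym_grp)
  obtain a where a: "\<forall>\<sigma>\<in>sym_grp n. f \<sigma> = (\<Sum>i=1..n. a i (\<sigma> i))" and f: "f \<in> perm_funs n"
    using assms(1) by (auto simp: linear_funs_def)
  have "rtrans ?t f \<sigma> = (\<Sum>i=1..n. a (?t i) (\<sigma> i))" if "\<sigma> \<in> sym_grp n" for \<sigma>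
  proof -
    have b: "bij_betw ?t {1..n} {1..n}" using assms by (intro bij_betw_transpose_iff) auto
    have "(\<Sum>i=1..n. a (?t i) (\<sigma> (?t (?t i)))) = (\<Sum>i=1..n. a i (\<sigma> (?t i)))"
      by (rule sum.reindex_bij_betw[OF b, of "\<lambda>i. a i (\<sigma> (?t i))"])
    then show ?thesis using a sym_grp_comp_iff[OF t] that by (simp add: rtrans_apply)
  qed
  then show ?thesis by (intro linear_funsI[where a = "\<lambda>i. a (?t i)"] rtrans_perm_funs[OF t f])
qed

section \<open>Joint eigenvectors of the trivial and of the standard representation\<close>

lemma adj_invariant:
  assumes "\<And>k. 1 \<le> k \<Longrightarrow> k < m \<Longrightarrow> adj k v = v" "\<tau> permutes {1..m}"
  shows "v (\<sigma> \<circ> \<tau>) = v \<sigma>"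
proof -
  have t: "rtrans (transpose p q) v = v" if "1 \<le> p" "p < q" "q \<le> m" for p q
    using that(2,3)
  proof (induction q)
    case (Suc q)
    show ?case
    proof (cases "p = q")
      case True
      then show ?thesis using assms(1)[of q] that Suc.prems by auto
    next
      case False
      have "transpose p (Suc q) = transpose q (Suc q) \<circ> (transpose p q \<circ> transpose q (Suc q))"
        using False Suc.prems by (auto simp: fun_eq_iff transpose_def)
      then have "rtrans (transpose p (Suc q)) v = adj q (rtrans (transpose p q) (adj q v))"
        by (simp add: rtrans_rtrans)
      then show ?thesis using Suc False assms(1)[of q] that by simp
    qed
  qed simp
  have t': "v (\<sigma> \<circ> transpose p q) = v \<sigma>" if "p \<in> {1..m}" "q \<in> {1..m}" for p q \<sigma>
  proof (cases p q rule: linorder_cases)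
    case less
    then have "rtrans (transpose p q) v \<sigma> = v \<sigma>" using t[of p q] that by simp
    then show ?thesis by (simp add: rtrans_apply)
  next
    case greater
    then have "rtrans (transpose q p) v \<sigma> = v \<sigma>" using t[of q p] that by simp
    then show ?thesis by (simp add: rtrans_apply transpose_commute)
  qed simp
  have "\<forall>\<sigma>. v (\<sigma> \<circ> \<tau>) = v \<sigma>"
    using assms(2) finite_atLeastAtMost
  proof (induction rule: permutes_induct)
    case (swap a b p)
    have "v (\<sigma> \<circ> (transpose a b \<circ> p)) = v \<sigma>" for \<sigma>
      using swap.IH t'[OF swap.hyps(1,2), of \<sigma>] unfolding comp_assoc[symmetric] by metis
    then show ?case by blast
  qed auto
  then show ?thesis by blast
qed

text \<open>Consecutive contents differ by \<open>1\<close>, so by \<open>adj_content\<close> every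
  adjacent transposition fixes \<open>v\<close>.\<close>

lemma trivial_content_constant:
  assumes cv: "content_vector n c v" and c: "\<And>k. k \<in> {1..n} \<Longrightarrow> c k = of_nat k - 1"
    and "\<sigma> \<in> sym_grp n"
  shows "v \<sigma> = v id"
proof -
  have "adj k v = v" if "1 \<le> k" "k < n" for k
    using adj_content[OF cv that] c[of k] c[of "Suc k"] that by simp
  then have "v (id \<circ> \<sigma>) = v id"
    using assms(3) by (intro adj_invariant[where m = n]) (auto simp: sym_grp_def)
  then show ?thesis by simp
qed

text \<open>Downward induction on the position of \<open>- 1\<close>. If it is last,
  \<open>v\<close> is fixed by all permutations of the first \<open>n - 1\<close> positions and so
  depends on \<open>\<sigma> n\<close> only. Otherwise the contents at \<open>j\<close> and
  \<open>Suc j\<close> differ by \<open>j\<close>, which is at least \<open>2\<close>: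
  \<open>swapped\<close> moves \<open>- 1\<close> one place later, and \<open>adj_swapped\<close>
  recovers \<open>v\<close> from it.\<close>

lemma standard_content_linear:
  assumes "content_vector n c v" "j \<in> {2..n}"
    "\<And>k. k \<in> {1..n} \<Longrightarrow> c k = (if k < j then of_nat k - 1 else if k = j then - 1 else of_nat k - 2)"
  shows "v \<in> linear_funs n"
proof -
  have "j \<le> n" "2 \<le> j" using assms(2) by auto
  then show ?thesis using assms(1,3)
  proof (induction j arbitrary: c v rule: inc_induct)
    case base
    have "adj k v = v" if "1 \<le> k" "k < n - 1" for k
    proof -
      have "Suc k < n" using that by simp
      then show ?thesis using adj_content[OF base.prems(2), of k] base.prems(3)[of k] base.prems(3)[of "Suc k"] that by simp
    qed
    then have inv: "v (\<sigma> \<circ> \<tau>) = v \<sigma>" if "\<tau> permutes {1..n - 1}" for \<sigma> \<tau>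
      using that by (intro adj_invariant[where m = "n - 1"])
    have dep: "v \<sigma> = v \<tau>" if s: "\<sigma> \<in> sym_grp n" "\<tau> \<in> sym_grp n" "\<sigma> n = \<tau> n" for \<sigma> \<tau>
    proof -
      have s': "\<sigma> permutes {1..n}" "\<tau> permutes {1..n}" using s by (auto simp: sym_grp_def)
      have p: "inv \<sigma> \<circ> \<tau> permutes {1..n}" using s' by (intro permutes_compose permutes_inv)
      have "(inv \<sigma> \<circ> \<tau>) n = n" using s(3) permutes_inverses(2)[OF s'(1), of n] by simp
      then have "inv \<sigma> \<circ> \<tau> permutes {1..n - 1}"
        by (intro permutes_superset[OF p]) (auto simp: not_le le_less_Suc_eq dest!: le_antisym)
      from inv[OF this, of \<sigma>] have "v (\<sigma> \<circ> (inv \<sigma> \<circ> \<tau>)) = v \<sigma>" .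
      moreover have "\<sigma> \<circ> (inv \<sigma> \<circ> \<tau>) = \<tau>"
        using permutes_inv_o(1)[OF s'(1)] by (simp flip: comp_assoc)
      ultimately show ?thesis by simp
    qed
    define a where "a i j = (if i = n then v (SOME \<sigma>. \<sigma> \<in> sym_grp n \<and> \<sigma> n = j) else 0)" for i j
    have "v \<sigma> = (\<Sum>i=1..n. a i (\<sigma> i))" if "\<sigma> \<in> sym_grp n" for \<sigma>
    proof -
      have "(\<Sum>i=1..n. a i (\<sigma> i)) = (\<Sum>i=1..n. if i = n then a n (\<sigma> n) else 0)"
        by (intro sum.cong) (auto simp: a_def)
      also have "\<dots> = a n (\<sigma> n)" using base.prems by auto
      also have "\<dots> = v (SOME \<tau>. \<tau> \<in> sym_grp n \<and> \<tau> n = \<sigma> n)" by (simp add: a_def)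
      also have "\<dots> = v \<sigma>"
        using someI[of "\<lambda>\<tau>. \<tau> \<in> sym_grp n \<and> \<tau> n = \<sigma> n" \<sigma>] that by (intro dep) auto
      finally show ?thesis by simp
    qed
    then show ?case by (intro linear_funsI[where a = a] content_vectorD(1)[OF base.prems(2)])
  next
    case (step j)
    note cv = step.prems(2) and c = step.prems(3)
    have j: "1 \<le> j" "j < n" using step by auto
    have d: "c (Suc j) - c j = of_nat j" using c[of j] c[of "Suc j"] j by simp
    have ne: "(of_nat j :: complex)\<^sup>2 \<noteq> 1"
    proof
      assume "(of_nat j :: complex)\<^sup>2 = 1"
      then have "(of_nat (j\<^sup>2) :: complex) = of_nat 1" by simp
      then have "j\<^sup>2 = 1" by (simp only: of_nat_eq_iff)
      then show False using step.prems(1) by (simp add: power2_eq_square)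
    qed
    let ?u = "swapped j c v"
    have cu: "content_vector n (c \<circ> transpose j (Suc j)) ?u"
      by (rule content_swap[OF cv j]) (use ne d in simp)
    have u: "?u \<in> linear_funs n"
    proof (rule step.IH[OF _ cu])
      fix k assume k: "k \<in> {1..n}"
      consider "k = j" | "k = Suc j" | "k \<noteq> j" "k \<noteq> Suc j" by blast
      then show "(c \<circ> transpose j (Suc j)) k
         = (if k < Suc j then of_nat k - 1 else if k = Suc j then - 1 else of_nat k - 2)"
        using c[of k] c[of j] c[of "Suc j"] k j by cases auto
    qed (use step.prems in simp)
    have "fscale (1 - 1 / (of_nat j)\<^sup>2) v = adj j ?u + fscale (1 / of_nat j) ?u"
      using adj_swapped[OF cv j] unfolding d .
    also have "\<dots> \<in> linear_funs n"
      using u j by (intro fv.subspace_add fv.subspace_scale subspace_linear_funs rtrans_linear_funs) auto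
    finally have "fscale (1 - 1 / (of_nat j)\<^sup>2) v \<in> linear_funs n" .
    then have "fscale (1 / (1 - 1 / (of_nat j)\<^sup>2)) (fscale (1 - 1 / (of_nat j)\<^sup>2) v) \<in> linear_funs n"
      by (rule fv.subspace_scale[OF subspace_linear_funs])
    moreover have "1 / (1 - 1 / (of_nat j :: complex)\<^sup>2) * (1 - 1 / (of_nat j)\<^sup>2) = 1"
    proof -
      have "1 - 1 / (of_nat j :: complex)\<^sup>2 \<noteq> 0" using ne j by (simp add: field_simps)
      then show ?thesis by simp
    qed
    ultimately show ?case by (simp only: fv.scale_scale fv.scale_one)
  qed
qed

section \<open>Functions of mean zero and the spectrum on them\<close>

definition indic :: "(nat \<Rightarrow> nat) set \<Rightarrow> perm_fun" where
  "indic A = (\<lambda>\<sigma>. if \<sigma> \<in> A then 1 else 0)"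

abbreviation one :: "nat \<Rightarrow> perm_fun" where
  "one n \<equiv> indic (sym_grp n)"

lemma indic_perm_funs: "A \<subseteq> sym_grp n \<Longrightarrow> indic A \<in> perm_funs n"
  by (auto simp: indic_def perm_funs_def)

lemma inner_indic: "A \<subseteq> sym_grp n \<Longrightarrow> inner n f (indic A) = (\<Sum>\<sigma>\<in>A. f \<sigma>)"
  by (auto simp: inner_def indic_def if_distrib[of cnj] if_distrib[of "(*) _"] sum.If_cases Int_absorb1
      cong: if_cong)

lemma jm_one: "j \<in> {1..n} \<Longrightarrow> jm j (one n) = fscale (of_real (real j - 1)) (one n)"
proof
  fix \<sigma> assume j: "j \<in> {1..n}"
  have "jm j (one n) \<sigma> = (\<Sum>i=1..<j. one n \<sigma>)"
    unfolding jm_apply indic_def using j by (intro sum.cong refl) (simp add: sym_grp_comp_iff transpose_in_sym_grp)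
  then show "jm j (one n) \<sigma> = fscale (of_real (real j - 1)) (one n) \<sigma>" using j by (simp add: of_nat_diff)
qed

lemma hoffman_op_one:
  assumes "2 \<le> n"
  shows "hoffman_op n (one n) = fscale (of_real (real (n - 1) * mu n)) (one n)"
proof -
  let ?x = "\<lambda>j. real j - 1"
  have e: "shift_prod ?x k = fact k \<and> shift_esym ?x k = fact k * hsum k \<and> shift_sum ?x k = real k * (real k + 1) / 2" for k
  proof (induction k)
    case (Suc k)
    then show ?case by (auto simp: hsum_Suc field_simps)
  qed simp
  have "eigenvalue n ?x = hweight n (n - 1) * fact (n - 1)
      + fact (n - 1) * (real (n - 1) * (real (n - 1) + 1) / 2 - (real n - 1) * hsum (n - 1))"
    unfolding eigenvalue_def conjunct1[OF e] conjunct1[OF conjunct2[OF e]] conjunct2[OF conjunct2[OF e]]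
    by (simp add: field_simps)
  also have "\<dots> = 2 * hweight n (n - 1) * fact (n - 1)" by (simp add: hweight_def)
  also have "\<dots> = real (n - 1) * mu n"
    using assms fact_reduce[of "n - 1", where 'a = real] by (simp add: mu_def numeral_2_eq_2)
  finally show ?thesis
    using hoffman_op_eigen[of n "one n" ?x] jm_one[of _ n] assms by simp
qed

definition mean_zero :: "nat \<Rightarrow> perm_fun set" where
  "mean_zero n = {f \<in> perm_funs n. inner n f (one n) = 0}"

lemma subspace_mean_zero: "fv.subspace (mean_zero n)"
  using subspace_perm_funs[of n]
  by (auto simp: fv.subspace_def mean_zero_def inner_add_left inner_scale_left inner_zero_left
      simp del: plus_fun_apply fscale_apply zero_fun_apply)

lemma jm_mean_zero:
  assumes "j \<in> {1..n}" "f \<in> mean_zero n"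
  shows "jm j f \<in> mean_zero n"
proof -
  have "inner n (jm j f) (one n) = inner n f (jm j (one n))" using assms(1) by (intro inner_jm) auto
  also have "\<dots> = cnj (of_real (real j - 1)) * inner n f (one n)"
    unfolding jm_one[OF assms(1)] inner_scale_right ..
  finally show ?thesis using assms jm_perm_funs[of j n f] by (simp add: mean_zero_def)
qed

lemma hoffman_op_mean_zero:
  assumes "2 \<le> n" "f \<in> mean_zero n"
  shows "hoffman_op n f \<in> mean_zero n"
proof -
  have "inner n (hoffman_op n f) (one n) = inner n f (hoffman_op n (one n))"
    using self_adjoint_hoffman_op[of n] assms(1) by (simp add: self_adjoint_def)
  also have "\<dots> = cnj (of_real (real (n - 1) * mu n)) * inner n f (one n)"
    unfolding hoffman_op_one[OF assms(1)] inner_scale_right ..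
  finally show ?thesis using assms hoffman_op_perm_funs[of n f] by (simp add: mean_zero_def)
qed

lemma hoffman_eigen_content:
  assumes n: "5 \<le> n" and x: "x \<in> mean_zero n" "x \<noteq> 0" and z: "hoffman_op n x = fscale z x"
    and c: "fv.joint_eigen jm n c x"
  shows "\<exists>r. z = of_real r \<and> - mu n \<le> r \<and> r < mu n \<and> (r = - mu n \<longrightarrow> x \<in> linear_funs n)"
proof -
  have cv: "content_vector n c x" using x c by (simp add: content_vector_def mean_zero_def)
  then have "c \<in> contents n" by (auto simp: contents_def)
  then obtain b where b: "content_sequence n b" "\<And>k. k \<in> {1..n} \<Longrightarrow> c k = of_int (b k)"
    using contents_content_sequence n by (metis le_trans one_le_numeral)
  interpret content_sequence n b by fact
  have "hoffman_op n x = fscale (of_real (eigenvalue n rb)) x"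
  proof (rule hoffman_op_eigen)
    fix j assume "j \<in> {2..n}"
    then have j: "j \<in> {1..n}" by simp
    show "jm j x = fscale (of_real (rb j)) x"
      using content_vectorD(3)[OF cv j] unfolding b(2)[OF j] by simp
  qed (use n in simp)
  moreover obtain \<sigma> where "x \<sigma> \<noteq> 0" using x(2) by (auto simp: fun_eq_iff)
  ultimately have z': "z = of_real (eigenvalue n rb)" using z by (metis fscale_apply mult_right_cancel)
  from assms(1) show ?thesis
  proof (cases rule: eigenvalue_cases)
    case 1
    have e: "c k = of_nat k - 1" if "k \<in> {1..n}" for k using 1(2)[OF that] b(2)[OF that] by simp
    have "x \<sigma> = x id" if "\<sigma> \<in> sym_grp n" for \<sigma>
      by (rule trivial_content_constant[OF cv e that])
    then have "inner n x (one n) = of_nat (fact n) * x id"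
      by (simp add: inner_indic card_sym_grp)
    then have "x id = 0" using x(1) by (simp add: mean_zero_def)
    then have "x = 0" using \<open>\<And>\<sigma>. \<sigma> \<in> sym_grp n \<Longrightarrow> x \<sigma> = x id\<close> x(1)
      by (force simp: mean_zero_def perm_funs_def fun_eq_iff)
    then show ?thesis using x(2) by simp
  next
    case (2 j)
    have "x \<in> linear_funs n"
    proof (rule standard_content_linear[OF cv 2(2)])
      fix k assume "k \<in> {1..n}"
      then show "c k = (if k < j then of_nat k - 1 else if k = j then - 1 else of_nat k - 2)"
        using 2(3)[of k] b(2)[of k] by auto
    qed
    then show ?thesis using z' 2(1) mu_pos[OF assms(1)] by auto
  next
    case 3
    then show ?thesis using z' by auto
  qed
qed

text \<open>Inside \<open>mean_zero n\<close> an eigenspace of \<open>hoffman_op n\<close> is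
  preserved by all Jucys--Murphy operators, hence spanned by their joint eigenvectors, to which
  \<open>hoffman_eigen_content\<close> applies.\<close>

lemma hoffman_eigen:
  assumes n: "5 \<le> n" and u: "u \<in> mean_zero n" "u \<noteq> 0" and z: "hoffman_op n u = fscale z u"
  shows "\<exists>r. z = of_real r \<and> - mu n \<le> r \<and> r < mu n \<and> (r = - mu n \<longrightarrow> u \<in> linear_funs n)"
proof -
  define S where "S = {f \<in> mean_zero n. hoffman_op n f = fscale z f}"
  have S: "fv.subspace S"
  proof (rule fv.subspaceI)
    show "0 \<in> S" unfolding S_def
      using fv.subspace_0[OF subspace_mean_zero] fv.linear_op_zero[OF linear_hoffman_op]
      by (auto simp: fv.scale_zero_right simp del: zero_fun_apply fscale_apply)
    show "x + y \<in> S" if "x \<in> S" "y \<in> S" for x y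
      using that fv.subspace_add[OF subspace_mean_zero] unfolding S_def
      by (auto simp: fv.linear_op_add[OF linear_hoffman_op] fv.scale_right_distrib simp del: plus_fun_apply fscale_apply)
    show "fscale c x \<in> S" if "x \<in> S" for c x
      using that fv.subspace_scale[OF subspace_mean_zero] unfolding S_def
      by (auto simp: fv.linear_op_scale[OF linear_hoffman_op] fv.scale_scale mult.commute simp del: fscale_apply)
  qed
  have SP: "S \<subseteq> perm_funs n" by (auto simp: S_def mean_zero_def)
  have jS: "jm k f \<in> S" if "k \<in> {1..n}" "f \<in> S" for k f
    using that jm_mean_zero[of k n f] unfolding S_def
    by (simp add: fv.linear_op_scale[OF linear_jm] flip: jm_hoffman_op del: fscale_apply)
  let ?E = "{x \<in> S. \<exists>c. fv.joint_eigen jm n c x}"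
  have "S \<subseteq> fv.span ?E"
  proof (rule fv.joint_eigen_span[where b = "delta ` sym_grp n"])
    show "fv.semisimple_on S (jm k)" if "k \<in> {1..n}" for k
      using that jS by (intro self_adjoint_semisimple[OF self_adjoint_jm linear_jm S SP]) auto
  qed (use S SP perm_funs_span[of n] jS in \<open>auto simp: linear_jm jm_commute\<close>)
  then have uE: "u \<in> fv.span ?E" using u z by (auto simp: S_def)
  have E: "\<exists>r. z = of_real r \<and> - mu n \<le> r \<and> r < mu n \<and> (r = - mu n \<longrightarrow> x \<in> linear_funs n)"
    if "x \<in> ?E" "x \<noteq> 0" for x
    using that hoffman_eigen_content[OF n, of x z] by (auto simp: S_def)
  obtain x0 where "x0 \<in> ?E" "x0 \<noteq> 0"
  proof (rule ccontr)
    assume "\<not> thesis"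
    then have "?E \<subseteq> {0}" using that by blast
    then have "fv.span ?E \<subseteq> fv.span {0}" by (rule fv.span_mono)
    then show False using uE u(2) by auto
  qed
  from E[OF this] obtain r where r: "z = of_real r" "- mu n \<le> r" "r < mu n" by blast
  have "u \<in> linear_funs n" if "r = - mu n"
  proof -
    have "?E \<subseteq> linear_funs n"
    proof
      fix x assume x: "x \<in> ?E"
      show "x \<in> linear_funs n"
      proof (cases "x = 0")
        case True
        then show ?thesis using fv.subspace_0[OF subspace_linear_funs] by (simp only:)
      next
        case False
        from E[OF x this] show ?thesis using r(1) that by auto
      qed
    qed
    then show ?thesis using fv.span_minimal[OF _ subspace_linear_funs] uE by blast
  qed
  then show ?thesis using r by blast
qed

text \<open>In an orthogonal eigenvector expansion both gaps are sums of nonnegative terms, and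
  equality annihilates each term: below, only linear components survive; above, none does, as every
  eigenvalue is strictly less than \<open>mu n\<close>.\<close>

lemma hoffman_quadratic_form:
  assumes n: "5 \<le> n" and x: "x \<in> mean_zero n"
  shows "- mu n * norm_sq n x \<le> Re (inner n (hoffman_op n x) x)"
    and "Re (inner n (hoffman_op n x) x) \<le> mu n * norm_sq n x"
    and "Re (inner n (hoffman_op n x) x) = - mu n * norm_sq n x \<Longrightarrow> x \<in> linear_funs n"
    and "Re (inner n (hoffman_op n x) x) = mu n * norm_sq n x \<Longrightarrow> x = 0"
proof -
  let ?M = "hoffman_op n"
  have sa: "self_adjoint n ?M" using n by (intro self_adjoint_hoffman_op) auto
  have MS: "?M f \<in> mean_zero n" if "f \<in> mean_zero n" for f
    using that n by (intro hoffman_op_mean_zero) auto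
  have P: "mean_zero n \<subseteq> perm_funs n" by (auto simp: mean_zero_def)
  have "fv.semisimple_on (mean_zero n) ?M"
    using MS by (intro self_adjoint_semisimple[OF sa linear_hoffman_op subspace_mean_zero P])
  moreover have "mean_zero n \<subseteq> fv.span (delta ` sym_grp n)" using P perm_funs_span[of n] by blast
  ultimately obtain Z F where Z: "finite Z" "x = sum F Z"
    and F: "\<forall>z\<in>Z. F z \<in> mean_zero n \<and> ?M (F z) = fscale z (F z)"
    using fv.eigen_decomposition[where T = ?M and S = "mean_zero n" and b = "delta ` sym_grp n" and x = x]
      linear_hoffman_op subspace_mean_zero MS x by auto
  have ev: "\<exists>r. z = of_real r \<and> - mu n \<le> r \<and> r < mu n \<and> (r = - mu n \<longrightarrow> F z \<in> linear_funs n)"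
    if "z \<in> Z" "F z \<noteq> 0" for z
    using that F by (intro hoffman_eigen[OF n]) auto
  have orth: "inner n (F z) (F w) = (if z = w then of_real (norm_sq n (F z)) else 0)" if "z \<in> Z" "w \<in> Z" for z w
  proof (cases "z = w \<or> F w = 0")
    case True
    then show ?thesis by (auto simp: inner_self inner_zero_right norm_sq_def simp del: of_real_sum)
  next
    case False
    from ev[OF that(2)] False obtain r where r: "w = of_real r" by blast
    have "inner n (?M (F z)) (F w) = inner n (F z) (?M (F w))" using sa by (simp add: self_adjoint_def)
    then have "z * inner n (F z) (F w) = w * inner n (F z) (F w)"
      using F that r by (simp add: inner_scale_left inner_scale_right del: fscale_apply)
    then show ?thesis using False by auto
  qed
  have ns: "norm_sq n x = (\<Sum>z\<in>Z. norm_sq n (F z))"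
  proof -
    have "inner n x x = (\<Sum>z\<in>Z. \<Sum>w\<in>Z. inner n (F z) (F w))"
      unfolding Z(2) inner_sum_left inner_sum_right by (rule sum.swap)
    also have "\<dots> = (\<Sum>z\<in>Z. of_real (norm_sq n (F z)))"
      using Z(1) by (intro sum.cong refl) (simp add: orth)
    finally show ?thesis unfolding inner_self by (simp only: of_real_sum[symmetric] of_real_eq_iff)
  qed
  have qf: "Re (inner n (?M x) x) = (\<Sum>z\<in>Z. Re z * norm_sq n (F z))"
  proof -
    have "inner n (?M x) x = (\<Sum>z\<in>Z. \<Sum>w\<in>Z. inner n (?M (F z)) (F w))"
      unfolding Z(2) fv.linear_op_sum[OF linear_hoffman_op] inner_sum_left inner_sum_right by (rule sum.swap)
    also have "\<dots> = (\<Sum>z\<in>Z. \<Sum>w\<in>Z. z * inner n (F z) (F w))"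
      using F by (intro sum.cong refl) (simp add: inner_scale_left del: fscale_apply)
    also have "\<dots> = (\<Sum>z\<in>Z. \<Sum>w\<in>Z. if z = w then z * of_real (norm_sq n (F z)) else 0)"
      by (intro sum.cong refl) (simp add: orth)
    also have "\<dots> = (\<Sum>z\<in>Z. z * of_real (norm_sq n (F z)))"
      using Z(1) by simp
    finally show ?thesis by simp
  qed
  have lo: "(Re z + mu n) * norm_sq n (F z) \<ge> 0" and hi: "(mu n - Re z) * norm_sq n (F z) \<ge> 0" if "z \<in> Z" for z
  proof -
    have "(Re z + mu n) * norm_sq n (F z) \<ge> 0 \<and> (mu n - Re z) * norm_sq n (F z) \<ge> 0"
    proof (cases "F z = 0")
      case True
      then show ?thesis by (simp add: norm_sq_def)
    next
      case False
      then show ?thesis using ev[OF that] norm_sq_nonneg[of n "F z"] by auto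
    qed
    then show "(Re z + mu n) * norm_sq n (F z) \<ge> 0" "(mu n - Re z) * norm_sq n (F z) \<ge> 0" by auto
  qed
  have lo': "Re (inner n (?M x) x) + mu n * norm_sq n x = (\<Sum>z\<in>Z. (Re z + mu n) * norm_sq n (F z))"
    by (simp add: qf ns sum_distrib_left sum.distrib algebra_simps)
  have hi': "mu n * norm_sq n x - Re (inner n (?M x) x) = (\<Sum>z\<in>Z. (mu n - Re z) * norm_sq n (F z))"
    by (simp add: qf ns sum_distrib_left sum_subtractf algebra_simps)
  show "- mu n * norm_sq n x \<le> Re (inner n (?M x) x)" 
    using lo' sum_nonneg[of Z "\<lambda>z. (Re z + mu n) * norm_sq n (F z)"] lo by auto
  show "Re (inner n (?M x) x) \<le> mu n * norm_sq n x" 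
    using hi' sum_nonneg[of Z "\<lambda>z. (mu n - Re z) * norm_sq n (F z)"] hi by auto
  have F0: "F z = 0 \<longleftrightarrow> norm_sq n (F z) = 0" if "z \<in> Z" for z
    using norm_sq_eq_0_iff[of "F z" n] F P that by auto
  show "x \<in> linear_funs n" if "Re (inner n (?M x) x) = - mu n * norm_sq n x"
  proof -
    have "(\<Sum>z\<in>Z. (Re z + mu n) * norm_sq n (F z)) = 0" using lo' that by simp
    then have *: "\<forall>z\<in>Z. (Re z + mu n) * norm_sq n (F z) = 0"
      using Z(1) lo by (subst (asm) sum_nonneg_eq_0_iff) auto
    have "F z \<in> linear_funs n" if z: "z \<in> Z" for z
    proof (cases "F z = 0")
      case True
      then show ?thesis using fv.subspace_0[OF subspace_linear_funs] by (simp only:)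
    next
      case False
      then have "Re z + mu n = 0" using * F0[OF z] z by auto
      then show ?thesis using ev[OF z False] by auto
    qed
    then show ?thesis unfolding Z(2) by (intro fv.subspace_sum subspace_linear_funs)
  qed
  show "x = 0" if "Re (inner n (?M x) x) = mu n * norm_sq n x"
  proof -
    have "(\<Sum>z\<in>Z. (mu n - Re z) * norm_sq n (F z)) = 0" using hi' that by simp
    then have *: "\<forall>z\<in>Z. (mu n - Re z) * norm_sq n (F z) = 0"
      using Z(1) hi by (subst (asm) sum_nonneg_eq_0_iff) auto
    have "F z = 0" if z: "z \<in> Z" for z
    proof (rule ccontr)
      assume "F z \<noteq> 0"
      then show False using * F0[OF z] z ev[OF z] by auto
    qed
    then show ?thesis unfolding Z(2) by (intro sum.neutral) blast
  qed
qed

section \<open>The equality case of the Hoffman bound\<close>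

text \<open>Here \<open>p\<close>, \<open>q\<close> are the sizes of the families, \<open>s\<close>
  is \<open>(n - 1)!\<close>, and the right side of the last premise is the product of the squared
  norms of the centred indicators. Expanded with \<open>p q = s^2\<close> it says
  \<open>p + q \<le> 2 s\<close>, the reverse of the inequality of arithmetic and geometric
  means.\<close>

lemma product_bound:
  fixes n s p q :: real
  assumes n: "n \<ge> 1" and s: "s > 0" and pq: "p > 0" "q > 0" "p * q = s\<^sup>2"
    and ge: "(s * (n - 1) / n)\<^sup>2 \<le> (p - p\<^sup>2 / (n * s)) * (q - q\<^sup>2 / (n * s))"
  shows "p = s" "q = s"
proof -
  have "(p - p\<^sup>2 / (n * s)) * (q - q\<^sup>2 / (n * s)) = p * q - p * q * (p + q) / (n * s) + (p * q)\<^sup>2 / (n * s)\<^sup>2"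
    using n s by (simp add: field_simps power2_eq_square)
  also have "\<dots> = s\<^sup>2 - s * (p + q) / n + s\<^sup>2 / n\<^sup>2"
    using n s unfolding pq(3) by (simp add: power2_eq_square)
  finally have "(s * (n - 1) / n)\<^sup>2 \<le> s\<^sup>2 - s * (p + q) / n + s\<^sup>2 / n\<^sup>2" using ge by simp
  moreover have "(s * (n - 1) / n)\<^sup>2 = s\<^sup>2 - s * (2 * s) / n + s\<^sup>2 / n\<^sup>2"
    using n by (simp add: field_simps power2_eq_square)
  ultimately have "s * (p + q) / n \<le> s * (2 * s) / n" by linarith
  then have le: "p + q \<le> 2 * s" using n s by (simp add: divide_le_cancel)
  have "(p - q)\<^sup>2 = (p + q)\<^sup>2 - 4 * s\<^sup>2" unfolding pq(3)[symmetric] by (simp add: power2_eq_square algebra_simps)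
  moreover have "(p + q)\<^sup>2 \<le> (2 * s)\<^sup>2" using le pq s by (intro power_mono) auto
  ultimately have "(p - q)\<^sup>2 \<le> 0" by (simp add: power2_eq_square)
  then have "p = q" by simp
  then have "p\<^sup>2 = s\<^sup>2" using pq(3) by (simp add: power2_eq_square)
  then show "p = s" using pq s by (simp add: power2_eq_iff)
  then show "q = s" using \<open>p = q\<close> by simp
qed

lemma norm_sq_combination:
  "norm_sq n (fscale (of_real b) f + fscale (of_real a) g) + norm_sq n (fscale (of_real b) f - fscale (of_real a) g)
     = 2 * b\<^sup>2 * norm_sq n f + 2 * a\<^sup>2 * norm_sq n g"
proof -
  have "complex_of_real (norm_sq n (fscale (of_real b) f + fscale (of_real a) g)
      + norm_sq n (fscale (of_real b) f - fscale (of_real a) g))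
     = of_real (2 * b\<^sup>2 * norm_sq n f + 2 * a\<^sup>2 * norm_sq n g)"
    unfolding of_real_add of_real_mult inner_self[symmetric] inner_add_left inner_add_right inner_diff_left inner_diff_right
      inner_scale_left inner_scale_right
    by (simp add: power2_eq_square algebra_simps)
  then show ?thesis by (simp only: of_real_eq_iff)
qed

lemma quadratic_form_polarization:
  fixes f g :: perm_fun and a b :: real
  assumes M: "fv.linear_op M" and sa: "self_adjoint n M"
  defines "x \<equiv> fscale (of_real b) f + fscale (of_real a) g" and "y \<equiv> fscale (of_real b) f - fscale (of_real a) g"
  shows "Re (inner n (M x) x) - Re (inner n (M y) y) = 4 * a * b * Re (inner n (M g) f)"
proof -
  have "inner n (M f) g = cnj (inner n (M g) f)"
    using sa unfolding self_adjoint_def by (metis inner_commute)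
  then have "inner n (M x) x - inner n (M y) y = of_real (2 * a * b) * (inner n (M g) f + cnj (inner n (M g) f))"
    unfolding x_def y_def fv.linear_op_add[OF M] fv.linear_op_diff[OF M] fv.linear_op_scale[OF M]
      inner_add_left inner_add_right inner_diff_left inner_diff_right inner_scale_left inner_scale_right
    by (simp add: algebra_simps)
  also have "\<dots> = of_real (4 * a * b * Re (inner n (M g) f))"
    by (simp add: complex_add_cnj)
  finally show ?thesis by (metis Re_complex_of_real minus_complex.sel(1))
qed

lemma inner_indic_indic: "A \<subseteq> sym_grp n \<Longrightarrow> B \<subseteq> sym_grp n \<Longrightarrow> inner n (indic A) (indic B) = of_nat (card (A \<inter> B))"
  by (simp add: inner_indic) (simp add: indic_def sum.If_cases finite_subset[OF _ finite_sym_grp] Int_commute)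

definition centred :: "nat \<Rightarrow> (nat \<Rightarrow> nat) set \<Rightarrow> perm_fun" where
  "centred n A = indic A - fscale (of_real (real (card A) / fact n)) (one n)"

lemma inner_one_one: "inner n (one n) (one n) = of_real (fact n)"
  by (simp add: inner_indic_indic card_sym_grp)

lemma centred_mean_zero:
  assumes "A \<subseteq> sym_grp n"
  shows "centred n A \<in> mean_zero n"
proof -
  have "inner n (centred n A) (one n) = 0"
    unfolding centred_def inner_diff_left inner_scale_left inner_one_one
    using assms by (simp add: inner_indic_indic Int_absorb2)
  moreover have "centred n A \<in> perm_funs n"
    unfolding centred_def using assms
    by (intro fv.subspace_diff fv.subspace_scale subspace_perm_funs indic_perm_funs) auto
  ultimately show ?thesis by (simp add: mean_zero_def)
qed

lemma norm_sq_centred: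
  assumes "A \<subseteq> sym_grp n"
  shows "norm_sq n (centred n A) = real (card A) - (real (card A))\<^sup>2 / fact n"
proof -
  have "complex_of_real (norm_sq n (centred n A)) = of_real (real (card A) - (real (card A))\<^sup>2 / fact n)"
    unfolding inner_self[symmetric] centred_def inner_diff_left inner_diff_right inner_scale_left inner_scale_right inner_one_one
    using assms by (simp add: inner_indic_indic Int_absorb1 Int_absorb2 power2_eq_square)
  then show ?thesis by (simp only: of_real_eq_iff)
qed

lemma cross_intersecting_inner:
  assumes "2 \<le> n" "A \<subseteq> sym_grp n" "B \<subseteq> sym_grp n" "cross_intersecting n A B"
  shows "inner n (hoffman_op n (indic B)) (indic A) = 0"
proof -
  have fin: "finite B" using assms(3) finite_sym_grp finite_subset by blast
  have "indic B = (\<Sum>\<tau>\<in>B. delta \<tau>)"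
  proof
    fix \<sigma>
    have "(\<Sum>\<tau>\<in>B. delta \<tau>) \<sigma> = (\<Sum>\<tau>\<in>B. if \<sigma> = \<tau> then 1 else 0)"
      unfolding sum_fun_apply by (simp add: delta_def)
    then show "indic B \<sigma> = (\<Sum>\<tau>\<in>B. delta \<tau>) \<sigma>" using fin by (simp add: indic_def)
  qed
  then have "hoffman_op n (indic B) \<sigma> = 0" if "\<sigma> \<in> A" for \<sigma>
  proof -
    have "hoffman_op n (delta \<tau>) \<sigma> = 0" if \<tau>: "\<tau> \<in> B" for \<tau>
    proof -
      obtain m where "m \<in> {1..n}" "\<sigma> m = \<tau> m"
        using assms(4) \<open>\<sigma> \<in> A\<close> \<tau> unfolding cross_intersecting_def by blast
      then show ?thesis using assms \<open>\<sigma> \<in> A\<close> \<tau> by (intro hoffman_op_delta_eq_0) auto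
    qed
    then show ?thesis
      unfolding \<open>indic B = _\<close> fv.linear_op_sum[OF linear_hoffman_op] sum_fun_apply by simp
  qed
  then show ?thesis using assms(2) by (simp add: inner_indic)
qed

lemma inner_hoffman_centred:
  assumes "2 \<le> n" "A \<subseteq> sym_grp n" "B \<subseteq> sym_grp n" "cross_intersecting n A B"
  shows "inner n (hoffman_op n (centred n B)) (centred n A)
    = of_real (- (real (n - 1) * mu n * real (card A) * real (card B) / fact n))"
proof -
  have sa: "self_adjoint n (hoffman_op n)" using assms by (intro self_adjoint_hoffman_op) auto
  have 1: "inner n (hoffman_op n (indic B)) (one n) = of_real (real (n - 1) * mu n) * of_nat (card B)"
  proof -
    have "inner n (hoffman_op n (indic B)) (one n) = inner n (indic B) (hoffman_op n (one n))"
      using sa by (simp add: self_adjoint_def)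
    then show ?thesis unfolding hoffman_op_one[OF assms(1)] inner_scale_right
      using assms by (simp add: inner_indic_indic Int_absorb2)
  qed
  have 2: "inner n (one n) (indic A) = of_nat (card A)"
    using assms by (simp add: inner_indic_indic Int_absorb1)
  show ?thesis
    unfolding centred_def fv.linear_op_diff[OF linear_hoffman_op] fv.linear_op_scale[OF linear_hoffman_op]
      hoffman_op_one[OF assms(1)] inner_diff_left inner_diff_right inner_scale_left inner_scale_right
      inner_one_one cross_intersecting_inner[OF assms] 1 2
    by simp
qed

lemma hoffman_equality:
  assumes n: "5 \<le> n" and A: "A \<subseteq> sym_grp n" and B: "B \<subseteq> sym_grp n" and ci: "cross_intersecting n A B"
    and card: "card A * card B = (fact (n - 1))\<^sup>2"
  shows "A = B" "card A = fact (n - 1)" "indic A \<in> linear_funs n"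
proof -
  let ?M = "hoffman_op n"
  define f where "f = centred n A"
  define g where "g = centred n B"
  define p where "p = real (card A)"
  define q where "q = real (card B)"
  define s where "s = (fact (n - 1) :: real)"
  have sp: "s > 0" by (simp add: s_def)
  have N: "fact n = real n * s" using n by (simp add: s_def fact_reduce)
  have pq: "p * q = s\<^sup>2" using arg_cong[OF card, of real] by (simp add: p_def q_def s_def)
  then have "p * q > 0" using sp by simp
  moreover have "p \<ge> 0" "q \<ge> 0" by (simp_all add: p_def q_def)
  ultimately have pos: "p > 0" "q > 0" by (auto simp: zero_less_mult_iff)
  have mu: "mu n > 0" by (rule mu_pos[OF n])
  have fg: "f \<in> mean_zero n" "g \<in> mean_zero n" using A B by (auto simp: f_def g_def centred_mean_zero)
  define a where "a = sqrt (norm_sq n f)"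
  define b where "b = sqrt (norm_sq n g)"
  have ab: "a\<^sup>2 = norm_sq n f" "b\<^sup>2 = norm_sq n g" "a \<ge> 0" "b \<ge> 0"
    by (auto simp: a_def b_def norm_sq_nonneg)
  have nf: "norm_sq n f = p - p\<^sup>2 / (n * s)" "norm_sq n g = q - q\<^sup>2 / (n * s)"
    using A B by (simp_all add: f_def g_def p_def q_def norm_sq_centred N)
  have "inner n (?M g) f = of_real (- (real (n - 1) * mu n * p * q / fact n))"
    unfolding f_def g_def p_def q_def using n by (intro inner_hoffman_centred A B ci) auto
  also have "real (n - 1) * mu n * p * q / fact n = mu n * (s * (n - 1) / n)"
    using n sp unfolding mult.assoc pq N by (simp add: power2_eq_square)
  finally have ip: "Re (inner n (?M g) f) = - (mu n * (s * (n - 1) / n))" by simp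
  have ip0: "Re (inner n (?M g) f) < 0" unfolding ip using mu sp n by simp
  have "a \<noteq> 0"
  proof
    assume "a = 0"
    then have "f = 0" using ab fg by (simp add: mean_zero_def norm_sq_eq_0_iff)
    then show False using ip0 by (simp add: inner_def)
  qed
  moreover have "b \<noteq> 0"
  proof
    assume "b = 0"
    then have "g = 0" using ab fg by (simp add: mean_zero_def norm_sq_eq_0_iff)
    then have "?M g = 0" by (simp only: fv.linear_op_zero[OF linear_hoffman_op])
    then show False using ip0 by (simp add: inner_def)
  qed
  ultimately have abp: "a > 0" "b > 0" using ab by auto
  \<comment> \<open>The two summands have the same norm \<open>a * b\<close>, which makes the
    polarization sharp.\<close>
  define x where "x = fscale (of_real b) f + fscale (of_real a) g"
  define y where "y = fscale (of_real b) f - fscale (of_real a) g"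
  have x: "x \<in> mean_zero n" and y: "y \<in> mean_zero n"
    unfolding x_def y_def using fg
    by (auto intro!: fv.subspace_add fv.subspace_diff fv.subspace_scale subspace_mean_zero simp del: plus_fun_apply fscale_apply minus_apply)
  have pol: "Re (inner n (?M x) x) - Re (inner n (?M y) y) = 4 * a * b * Re (inner n (?M g) f)"
    unfolding x_def y_def using n by (intro quadratic_form_polarization linear_hoffman_op self_adjoint_hoffman_op) auto
  have nxy: "norm_sq n x + norm_sq n y = 4 * a\<^sup>2 * b\<^sup>2"
    unfolding x_def y_def norm_sq_combination ab(1,2)[symmetric] by simp
  note Qx = hoffman_quadratic_form[OF n x] and Qy = hoffman_quadratic_form[OF n y]
  have "4 * a * b * (mu n * (s * (n - 1) / n)) \<le> mu n * (norm_sq n x + norm_sq n y)"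
    using pol Qx(1) Qy(2) unfolding ip by (simp add: algebra_simps)
  then have "(4 * a * b * mu n) * (s * (n - 1) / n) \<le> (4 * a * b * mu n) * (a * b)"
    unfolding nxy by (simp add: power2_eq_square algebra_simps)
  moreover have "4 * a * b * mu n > 0" using abp mu by simp
  ultimately have key: "s * (n - 1) / n \<le> a * b" by (rule mult_left_le_imp_le)
  have "(s * (n - 1) / n)\<^sup>2 \<le> (a * b)\<^sup>2" using key sp by (intro power_mono) auto
  also have "\<dots> = (p - p\<^sup>2 / (n * s)) * (q - q\<^sup>2 / (n * s))" unfolding power_mult_distrib ab(1,2) nf ..
  finally have eq: "p = s" "q = s"
    using product_bound[of "real n" s p q] sp pos pq n by (auto simp: of_nat_diff)
  then have cards: "card A = fact (n - 1)" "card B = fact (n - 1)"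
    unfolding p_def q_def s_def by (metis of_nat_eq_iff of_nat_fact)+
  have "a\<^sup>2 = b\<^sup>2" unfolding ab(1,2) nf eq ..
  then have "a = b" using ab(3,4) by (rule power2_eq_imp_eq)
  have a2: "a\<^sup>2 = s * (n - 1) / n"
    unfolding ab(1) nf eq using n sp by (simp add: field_simps power2_eq_square of_nat_diff)
  \<comment> \<open>The slack of the lower bound at \<open>x\<close> and that of the upper bound at
    \<open>y\<close> are nonnegative with sum zero, so both bounds are attained.\<close>
  have tot: "(Re (inner n (?M x) x) + mu n * norm_sq n x) + (mu n * norm_sq n y - Re (inner n (?M y) y)) = 0"
  proof -
    have "(Re (inner n (?M x) x) + mu n * norm_sq n x) + (mu n * norm_sq n y - Re (inner n (?M y) y))
      = 4 * a * b * Re (inner n (?M g) f) + mu n * (norm_sq n x + norm_sq n y)"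
      using pol by (simp add: algebra_simps)
    also have "\<dots> = 0"
      unfolding ip nxy a2[symmetric] \<open>a = b\<close>[symmetric] by (simp add: power2_eq_square)
    finally show ?thesis .
  qed
  have xl: "x \<in> linear_funs n" using tot Qx(1) Qy(2) by (intro Qx(3)) simp
  have "y = 0" using tot Qx(1) Qy(2) by (intro Qy(4)) simp
  have fge: "f = g"
  proof
    fix \<sigma>
    have "y \<sigma> = 0" using \<open>y = 0\<close> by simp
    then show "f \<sigma> = g \<sigma>" using abp unfolding y_def \<open>a = b\<close> by simp
  qed
  have "indic A \<sigma> = indic B \<sigma>" for \<sigma>
    using fun_cong[OF fge, of \<sigma>] cards unfolding f_def g_def centred_def by simp
  then show "A = B" by (auto simp: indic_def split: if_splits) (metis zero_neq_one)+
  show "card A = fact (n - 1)" by fact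
  have one: "one n \<in> linear_funs n"
  proof (rule linear_funsI[where a = "\<lambda>i j. if i = 1 then 1 else 0"])
    show "one n \<in> perm_funs n" by (rule indic_perm_funs) simp
    show "one n \<sigma> = (\<Sum>i=1..n. if i = 1 then 1 else 0)" if "\<sigma> \<in> sym_grp n" for \<sigma>
      using that n by (simp add: indic_def)
  qed
  \<comment> \<open>Since \<open>a = b\<close> and \<open>f = g\<close>, the function
    \<open>x\<close> is \<open>2 a f\<close>.\<close>
  have "indic A = fscale (of_real (1 / (2 * a))) x + fscale (of_real (p / fact n)) (one n)"
    using abp unfolding x_def fge[symmetric] \<open>a = b\<close>[symmetric] f_def centred_def p_def
    by (auto simp: fun_eq_iff field_simps)
  also have "\<dots> \<in> linear_funs n"
    using xl one by (intro fv.subspace_add fv.subspace_scale subspace_linear_funs)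
  finally show "indic A \<in> linear_funs n" .
qed

section \<open>Intersecting families with linear indicator\<close>

text \<open>
  Among the members of \<open>F\<close> take one with the fewest agreements with \<open>\<tau>\<close>: transposing an agreeing
  position with any other position of \<open>S\<close> would remove that agreement and create none.
\<close>

lemma exists_disagreeing:
  assumes F: "F \<noteq> {}" "\<And>\<sigma>. \<sigma> \<in> F \<Longrightarrow> inj \<sigma>"
    and closed: "\<And>\<sigma> x y. \<sigma> \<in> F \<Longrightarrow> x \<in> S \<Longrightarrow> y \<in> S \<Longrightarrow> \<sigma> \<circ> transpose x y \<in> F"
    and dis: "\<And>\<sigma> i. \<sigma> \<in> F \<Longrightarrow> i \<in> I - S \<Longrightarrow> \<sigma> i \<noteq> \<tau> i"
    and S: "2 \<le> card S" and \<tau>: "inj \<tau>"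
  shows "\<exists>\<sigma>\<in>F. \<forall>i\<in>I. \<sigma> i \<noteq> \<tau> i"
proof -
  have fin: "finite S" using S by (metis card.infinite not_numeral_le_zero)
  define ag where "ag \<sigma> = {i \<in> S. \<sigma> i = \<tau> i}" for \<sigma>
  obtain \<sigma> where \<sigma>: "\<sigma> \<in> F" and min: "\<And>\<rho>. \<rho> \<in> F \<Longrightarrow> card (ag \<sigma>) \<le> card (ag \<rho>)"
    using F(1) exists_least_iff[of "\<lambda>k. \<exists>\<sigma>\<in>F. card (ag \<sigma>) = k"] by (metis all_not_in_conv not_le)
  have "ag \<sigma> = {}"
  proof (rule ccontr)
    assume "ag \<sigma> \<noteq> {}"
    then obtain x where x: "x \<in> S" "\<sigma> x = \<tau> x" by (auto simp: ag_def)
    have "S - {x} \<noteq> {}" using S x fin by (metis One_nat_def card.empty card_Suc_Diff1 not_less_eq_eq numeral_2_eq_2 order_refl zero_neq_one le_zero_eq)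
    then obtain y where y: "y \<in> S" "y \<noteq> x" by blast
    have "ag (\<sigma> \<circ> transpose x y) \<subseteq> ag \<sigma> - {x}"
    proof
      fix i assume i: "i \<in> ag (\<sigma> \<circ> transpose x y)"
      have "\<sigma> y \<noteq> \<tau> x" using injD[OF F(2)[OF \<sigma>], of x y] x y by auto
      moreover have "\<sigma> x \<noteq> \<tau> y" using injD[OF \<tau>, of x y] x y by auto
      ultimately show "i \<in> ag \<sigma> - {x}"
        using i x y by (cases "i = x"; cases "i = y") (auto simp: ag_def)
    qed
    also have "\<dots> \<subset> ag \<sigma>" using x by (auto simp: ag_def)
    finally have "card (ag (\<sigma> \<circ> transpose x y)) < card (ag \<sigma>)"
      using fin by (intro psubset_card_mono) (auto simp: ag_def)
    then show False using min[OF closed[OF \<sigma> x(1) y(1)]] by simp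
  qed
  then show ?thesis using \<sigma> dis by (intro bexI[of _ \<sigma>]) (auto simp: ag_def)
qed

lemma card_point_stabilizer_coset:
  assumes "i \<in> {1..n}" "j \<in> {1..n}"
  shows "card {\<sigma> \<in> sym_grp n. \<sigma> i = j} = fact (n - 1)"
proof -
  let ?t = "transpose i j"
  have t: "?t permutes {1..n}" using assms by (rule permutes_swap_id)
  have "bij_betw (\<lambda>\<rho>. ?t \<circ> \<rho>) {\<rho>. \<rho> permutes {1..n} - {i}} {\<sigma> \<in> sym_grp n. \<sigma> i = j}"
  proof (rule bij_betwI[where g = "\<lambda>\<sigma>. ?t \<circ> \<sigma>"])
    show "(\<lambda>\<rho>. ?t \<circ> \<rho>) \<in> {\<rho>. \<rho> permutes {1..n} - {i}} \<rightarrow> {\<sigma> \<in> sym_grp n. \<sigma> i = j}"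
    proof
      fix \<rho> assume "\<rho> \<in> {\<rho>. \<rho> permutes {1..n} - {i}}"
      then have \<rho>: "\<rho> permutes {1..n} - {i}" by simp
      then have "\<rho> i = i" by (rule permutes_not_in) simp
      moreover have "\<rho> permutes {1..n}" using permutes_subset[OF \<rho>] by blast
      ultimately show "?t \<circ> \<rho> \<in> {\<sigma> \<in> sym_grp n. \<sigma> i = j}"
        using permutes_compose[OF _ t] by (auto simp: sym_grp_def)
    qed
    show "(\<lambda>\<sigma>. ?t \<circ> \<sigma>) \<in> {\<sigma> \<in> sym_grp n. \<sigma> i = j} \<rightarrow> {\<rho>. \<rho> permutes {1..n} - {i}}"
    proof
      fix \<sigma> assume "\<sigma> \<in> {\<sigma> \<in> sym_grp n. \<sigma> i = j}"
      then have \<sigma>: "\<sigma> permutes {1..n}" "\<sigma> i = j" by (auto simp: sym_grp_def)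
      have "?t \<circ> \<sigma> permutes {1..n}" using \<sigma> t by (intro permutes_compose)
      then have "?t \<circ> \<sigma> permutes {1..n} - {i}"
        by (rule permutes_superset) (use \<sigma> in auto)
      then show "?t \<circ> \<sigma> \<in> {\<rho>. \<rho> permutes {1..n} - {i}}" by simp
    qed
  qed (auto simp: comp_assoc[symmetric] simp del: comp_apply)
  then have "card {\<sigma> \<in> sym_grp n. \<sigma> i = j} = card {\<rho>. \<rho> permutes {1..n} - {i}}"
    by (simp add: bij_betw_same_card)
  also have "\<dots> = fact (n - 1)"
    using assms by (intro card_permutations) auto
  finally show ?thesis .
qed

text \<open>All summands at positions other than \<open>i\<close> and \<open>j\<close> cancel,
  leaving a function of the two values there.\<close>

lemma linear_indicator_swap:
  assumes A: "indic A \<in> linear_funs n" and ij: "i \<in> {1..n}" "j \<in> {1..n}" "i \<noteq> j"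
    and s: "\<sigma> \<in> sym_grp n" "\<tau> \<in> sym_grp n" "\<sigma> i = \<tau> i" "\<sigma> j = \<tau> j"
  shows "indic A \<sigma> - indic A (\<sigma> \<circ> transpose i j) = indic A \<tau> - indic A (\<tau> \<circ> transpose i j)"
proof -
  let ?t = "transpose i j"
  obtain a where a: "\<And>\<sigma>. \<sigma> \<in> sym_grp n \<Longrightarrow> indic A \<sigma> = (\<Sum>k=1..n. a k (\<sigma> k))"
    using A by (auto simp: linear_funs_def)
  have t: "?t \<in> sym_grp n" using ij by (intro transpose_in_sym_grp)
  have "indic A \<sigma> - indic A (\<sigma> \<circ> ?t) = a i (\<sigma> i) + a j (\<sigma> j) - a i (\<sigma> j) - a j (\<sigma> i)"
    if "\<sigma> \<in> sym_grp n" for \<sigma>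
  proof -
    have "indic A \<sigma> - indic A (\<sigma> \<circ> ?t) = (\<Sum>k=1..n. a k (\<sigma> k) - a k (\<sigma> (?t k)))"
      using a[of \<sigma>] a[of "\<sigma> \<circ> ?t"] sym_grp_comp_iff[OF t] that by (simp add: sum_subtractf)
    also have "\<dots> = (\<Sum>k\<in>{i, j}. a k (\<sigma> k) - a k (\<sigma> (?t k)))"
      using ij by (intro sum.mono_neutral_right) auto
    finally show ?thesis using ij by simp
  qed
  then show ?thesis using s by simp
qed

lemma linear_intersecting_dictator:
  assumes n: "5 \<le> n" and A: "A \<subseteq> sym_grp n" and int: "cross_intersecting n A A"
    and card: "card A = fact (n - 1)" and lin: "indic A \<in> linear_funs n"
  shows "\<exists>i\<in>{1..n}. \<exists>j\<in>{1..n}. A = {\<sigma> \<in> sym_grp n. \<sigma> i = j}"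
proof -
  have finA: "finite A" using A finite_sym_grp finite_subset by blast
  have perm: "\<sigma> permutes {1..n}" if "\<sigma> \<in> sym_grp n" for \<sigma> using that by (simp add: sym_grp_def)
  have inj: "inj \<sigma>" if "\<sigma> \<in> sym_grp n" for \<sigma> using perm[OF that] by (rule permutes_inj)
  have swap: "\<sigma> \<circ> transpose x y \<in> sym_grp n" if "\<sigma> \<in> sym_grp n" "x \<in> {1..n}" "y \<in> {1..n}" for \<sigma> x y
    using that sym_grp_comp_iff[OF transpose_in_sym_grp] by blast
  \<comment> \<open>A nonempty family closed under all adjacent transpositions would be the whole
    group, too large.\<close>
  have "\<exists>k \<sigma>. 1 \<le> k \<and> k < n \<and> \<sigma> \<in> A \<and> \<sigma> \<circ> transpose k (Suc k) \<notin> A"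
  proof (rule ccontr)
    assume no: "\<not> ?thesis"
    have "adj k (indic A) = indic A" if k: "1 \<le> k" "k < n" for k
    proof
      fix \<sigma>
      let ?t = "transpose k (Suc k)"
      have "\<sigma> \<circ> ?t \<in> A \<longleftrightarrow> \<sigma> \<in> A"
      proof
        show "\<sigma> \<in> A \<Longrightarrow> \<sigma> \<circ> ?t \<in> A" using no k by blast
        assume "\<sigma> \<circ> ?t \<in> A"
        then have "\<sigma> \<circ> ?t \<circ> ?t \<in> A" using no k by blast
        then show "\<sigma> \<in> A" by (simp add: comp_assoc)
      qed
      then show "adj k (indic A) \<sigma> = indic A \<sigma>" by (simp add: rtrans_apply indic_def)
    qed
    then have inv: "indic A (id \<circ> \<tau>) = indic A id" if "\<tau> \<in> sym_grp n" for \<tau>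
      using perm[OF that] by (intro adj_invariant[where m = n])
    obtain \<rho> where "\<rho> \<in> A" using card by (metis card.empty equals0I fact_nonzero)
    have "\<tau> \<in> A" if "\<tau> \<in> sym_grp n" for \<tau>
      using inv[OF that] inv[of \<rho>] \<open>\<rho> \<in> A\<close> A by (auto simp: indic_def split: if_splits)
    then have "A = sym_grp n" using A by blast
    then have "fact n = (fact (n - 1) :: nat)" using card card_sym_grp by metis
    then show False using n fact_reduce[of n, where 'a = nat] by simp
  qed
  then obtain k \<sigma> where k: "1 \<le> k" "k < n" and \<sigma>: "\<sigma> \<in> A" "\<sigma> \<circ> transpose k (Suc k) \<notin> A"
    by blast
  define i where "i = k"
  define i' where "i' = Suc k"
  have ii: "i \<in> {1..n}" "i' \<in> {1..n}" "i \<noteq> i'" using k by (auto simp: i_def i'_def)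
  define j where "j = \<sigma> i"
  define j' where "j' = \<sigma> i'"
  have \<sigma>G: "\<sigma> \<in> sym_grp n" using \<sigma> A by blast
  \<comment> \<open>The swap difference at \<open>\<sigma>\<close> is \<open>1\<close>, so it is
    \<open>1\<close> at every \<open>\<tau>\<close> with the same two values; for an indicator this
    leaves only \<open>\<tau> \<in> A\<close>.\<close>
  have full: "\<tau> \<in> A" if \<tau>: "\<tau> \<in> sym_grp n" "\<tau> i = j" "\<tau> i' = j'" for \<tau>
  proof -
    have "indic A \<tau> - indic A (\<tau> \<circ> transpose i i') = indic A \<sigma> - indic A (\<sigma> \<circ> transpose i i')"
      using \<tau> \<sigma>G ii by (intro linear_indicator_swap[OF lin]) (auto simp: j_def j'_def)
    also have "\<dots> = 1" using \<sigma> by (simp add: indic_def i_def i'_def)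
    finally show ?thesis by (auto simp: indic_def split: if_splits)
  qed
  have disj: "\<exists>m\<in>{1..n}. \<rho> m = \<tau> m" if "\<rho> \<in> A" "\<tau> \<in> A" for \<rho> \<tau>
    using int that by (auto simp: cross_intersecting_def)
  \<comment> \<open>A member of \<open>A\<close> missing both values would disagree everywhere with
    some member of the family that \<open>full\<close> puts into \<open>A\<close>.\<close>
  have either: "\<tau> i = j \<or> \<tau> i' = j'" if \<tau>: "\<tau> \<in> A" for \<tau>
  proof (rule ccontr)
    assume no: "\<not> ?thesis"
    let ?F = "{\<rho> \<in> sym_grp n. \<rho> i = j \<and> \<rho> i' = j'}"
    have "\<exists>\<rho>\<in>?F. \<forall>m\<in>{1..n}. \<rho> m \<noteq> \<tau> m"
    proof (rule exists_disagreeing[where S = "{1..n} - {i, i'}"])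
      show "?F \<noteq> {}" using \<sigma>G by (auto simp: j_def j'_def)
      show "2 \<le> card ({1..n} - {i, i'})" using ii n by (subst card_Diff_subset) auto
      show "inj \<tau>" using \<tau> A inj by blast
      show "inj \<rho>" if "\<rho> \<in> ?F" for \<rho> using that inj by blast
      show "\<rho> \<circ> transpose x y \<in> ?F" if "\<rho> \<in> ?F" "x \<in> {1..n} - {i, i'}" "y \<in> {1..n} - {i, i'}" for \<rho> x y
        using that swap[of \<rho> x y] by auto
      show "\<rho> m \<noteq> \<tau> m" if "\<rho> \<in> ?F" "m \<in> {1..n} - ({1..n} - {i, i'})" for \<rho> m
        using that no by auto
    qed
    then show False using full disj[OF _ \<tau>] by blast
  qed
  have "(\<forall>\<tau>\<in>A. \<tau> i = j) \<or> (\<forall>\<tau>\<in>A. \<tau> i' = j')"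
  proof (rule ccontr)
    assume "\<not> ?thesis"
    then obtain \<tau> \<rho> where \<tau>: "\<tau> \<in> A" "\<tau> i \<noteq> j" and \<rho>: "\<rho> \<in> A" "\<rho> i' \<noteq> j'" by blast
    have \<tau>': "\<tau> i' = j'" and \<rho>': "\<rho> i = j" using either \<tau> \<rho> by auto
    have G: "\<tau> \<in> sym_grp n" "\<rho> \<in> sym_grp n" using \<tau> \<rho> A by auto
    have "j' \<in> {1..n}" using permutes_in_image[OF perm[OF \<sigma>G]] ii by (simp add: j'_def)
    then obtain m where m: "m \<in> {1..n}" "\<rho> m = j'"
      using permutes_image[OF perm[OF G(2)]] by (metis imageE)
    have jj: "j \<noteq> j'" using injD[OF inj[OF \<sigma>G], of i i'] ii by (auto simp: j_def j'_def)
    have mi: "m \<noteq> i" "m \<noteq> i'" using m \<rho> \<rho>' jj by auto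
    define l where "l = \<rho> i'"
    \<comment> \<open>Exchanging \<open>i'\<close> and \<open>m\<close> turns a member of this
      family into one covered by \<open>full\<close>; comparing with \<open>\<rho>\<close>, which is
      in \<open>A\<close>, the whole family lies in \<open>A\<close>. At its three prescribed
      positions it disagrees with \<open>\<tau>\<close>, and \<open>n \<ge> 5\<close> leaves at
      least two free positions for \<open>exists_disagreeing\<close>.\<close>
    let ?F = "{\<pi> \<in> sym_grp n. \<pi> i = j \<and> \<pi> i' = l \<and> \<pi> m = j'}"
    have FA: "\<pi> \<in> A" if \<pi>: "\<pi> \<in> ?F" for \<pi>
    proof -
      have in_A: "\<pi> \<circ> transpose i' m \<in> A" if "\<pi> \<in> ?F" for \<pi>
        using that mi ii m swap[of \<pi> i' m] by (intro full) auto
      have "indic A \<pi> - indic A (\<pi> \<circ> transpose i' m) = indic A \<rho> - indic A (\<rho> \<circ> transpose i' m)"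
        using \<pi> G ii m mi by (intro linear_indicator_swap[OF lin]) (auto simp: l_def)
      moreover have "\<rho> \<in> ?F" using G \<rho>' m by (simp add: l_def)
      ultimately have "indic A \<pi> = 1"
        using in_A[OF \<pi>] in_A[of \<rho>] \<rho>(1) by (simp add: indic_def)
      then show ?thesis by (auto simp: indic_def split: if_splits)
    qed
    have "\<exists>\<pi>\<in>?F. \<forall>k\<in>{1..n}. \<pi> k \<noteq> \<tau> k"
    proof (rule exists_disagreeing[where S = "{1..n} - {i, i', m}"])
      have "\<rho> \<in> ?F" using G \<rho>' m by (simp add: l_def)
      then show "?F \<noteq> {}" by blast
      show "2 \<le> card ({1..n} - {i, i', m})" using ii n m mi by (subst card_Diff_subset) auto
      show "inj \<tau>" using G inj by blast
      show "inj \<pi>" if "\<pi> \<in> ?F" for \<pi> using that inj by blast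
      show "\<pi> \<circ> transpose x y \<in> ?F" if "\<pi> \<in> ?F" "x \<in> {1..n} - {i, i', m}" "y \<in> {1..n} - {i, i', m}" for \<pi> x y
        using that swap[of \<pi> x y] by auto
      show "\<pi> k \<noteq> \<tau> k" if "\<pi> \<in> ?F" "k \<in> {1..n} - ({1..n} - {i, i', m})" for \<pi> k
      proof -
        have "\<tau> m \<noteq> j'" using injD[OF inj[OF G(1)], of m i'] mi \<tau>' by auto
        then show ?thesis using that \<tau>(2) \<tau>' \<rho>(2) by (auto simp: l_def)
      qed
    qed
    then show False using FA disj[OF _ \<tau>(1)] by blast
  qed
  moreover have "A = {\<tau> \<in> sym_grp n. \<tau> p = \<sigma> p}" if "\<forall>\<tau>\<in>A. \<tau> p = \<sigma> p" "p \<in> {1..n}" for p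
  proof (rule card_subset_eq)
    have "\<sigma> p \<in> {1..n}" using permutes_in_image[OF perm[OF \<sigma>G]] that by simp
    then show "card A = card {\<tau> \<in> sym_grp n. \<tau> p = \<sigma> p}"
      using card card_point_stabilizer_coset[OF that(2)] by simp
  qed (use A that in auto)
  moreover have "\<sigma> p \<in> {1..n}" if "p \<in> {1..n}" for p
    using permutes_in_image[OF perm[OF \<sigma>G]] that by simp
  ultimately show ?thesis unfolding j_def j'_def using ii by blast
qed

section \<open>The case n = 4\<close>

fun agree :: "nat list \<Rightarrow> nat list \<Rightarrow> bool" where
  "agree (a # x) (b # y) = (if a = b then True else agree x y)"
| "agree _ _ = False"

text \<open>
  If \<open>card A * card B = 36\<close> and \<open>card A \<le> card B\<close>, then \<open>card A \<le> 6 \<le> card B\<close>. The search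
  therefore enumerates families \<open>X\<close> of at most six permutations for which at least six permutations
  \<open>N\<close> agree with all members of \<open>X\<close>.
\<close>

fun at_least_6 :: "'a list \<Rightarrow> bool" where
  "at_least_6 (_ # _ # _ # _ # _ # _ # _) = True"
| "at_least_6 _ = False"

text \<open>List indices start at \<open>0\<close>, values at \<open>1\<close>. The partners
  \<open>N\<close> are included because the common value has to be established for both
  families.\<close>

definition small_or_dictator :: "nat list list \<Rightarrow> nat list list \<Rightarrow> bool" where
  "small_or_dictator X N \<longleftrightarrow> length X * length N < 36 \<or>
     list_ex (\<lambda>i. list_ex (\<lambda>j. list_all (\<lambda>x. x ! i = j) (X @ N)) [1, 2, 3, 4]) [0, 1, 2, 3]"

fun search_families :: "nat list list \<Rightarrow> nat list list \<Rightarrow> nat list list \<Rightarrow> bool" where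
  "search_families [] X N = small_or_dictator X N"
| "search_families (x # xs) X N =
     (search_families xs X N \<and>
      (at_least_6 X \<or> (let N' = filter (agree x) N in \<not> at_least_6 N' \<or> search_families xs (x # X) N')))"

definition perms4 :: "nat list list" where
  "perms4 = filter distinct (product_lists [[1,2,3,4], [1,2,3,4], [1,2,3,4], [1,2,3,4]])"

lemma search_families_perms4: "search_families perms4 [] perms4"
  by code_simp

lemma distinct_perms4: "distinct perms4"
  by code_simp

lemma at_least_6_iff: "at_least_6 xs \<longleftrightarrow> 6 \<le> length xs"
  by (cases xs rule: at_least_6.cases) auto

text \<open>Follows the branch that picks exactly \<open>Y\<close> from \<open>xs\<close>. Neither
  pruning cuts it: at most six lists are picked in all, and the partner list, which only shrinks,
  still has six entries at the end.\<close>

lemma search_families_sound: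
  assumes "search_families xs X N" "distinct xs" "Y \<subseteq> set xs" "card Y + length X \<le> 6"
    "6 \<le> length (filter (\<lambda>z. \<forall>y\<in>Y. agree y z) N)"
  shows "\<exists>X'. set X' = set X \<union> Y \<and> length X' = length X + card Y \<and>
    small_or_dictator X' (filter (\<lambda>z. \<forall>y\<in>Y. agree y z) N)"
  using assms
proof (induction xs arbitrary: X N Y)
  case Nil
  then show ?case by (intro exI[of _ X]) auto
next
  case (Cons x xs)
  show ?case
  proof (cases "x \<in> Y")
    case False
    then show ?thesis using Cons.prems by (intro Cons.IH) auto
  next
    case True
    define Y' where "Y' = Y - {x}"
    have fin: "finite Y" using Cons.prems(3) finite_subset by blast
    have Y: "Y = insert x Y'" "x \<notin> Y'" "card Y = Suc (card Y')"
      using True card.remove[OF fin True] by (auto simp: Y'_def)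
    have eq: "filter (\<lambda>z. \<forall>y\<in>Y'. agree y z) (filter (agree x) N) = filter (\<lambda>z. \<forall>y\<in>Y. agree y z) N"
      unfolding Y by simp
    have "length (filter (\<lambda>z. \<forall>y\<in>Y'. agree y z) (filter (agree x) N)) \<le> length (filter (agree x) N)"
      by (rule length_filter_le)
    then have "at_least_6 (filter (agree x) N)" using Cons.prems(5) unfolding eq at_least_6_iff by simp
    moreover have "\<not> at_least_6 X" using Cons.prems(4) Y by (simp add: at_least_6_iff)
    ultimately have "search_families xs (x # X) (filter (agree x) N)"
      using Cons.prems(1) by (simp add: Let_def)
    then have "\<exists>X'. set X' = set (x # X) \<union> Y' \<and> length X' = length (x # X) + card Y' \<and>
        small_or_dictator X' (filter (\<lambda>z. \<forall>y\<in>Y'. agree y z) (filter (agree x) N))"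
      using Cons.prems Y unfolding eq[symmetric] by (intro Cons.IH) auto
    then show ?thesis unfolding eq using Y by auto
  qed
qed

definition perm_list :: "(nat \<Rightarrow> nat) \<Rightarrow> nat list" where
  "perm_list \<sigma> = [\<sigma> 1, \<sigma> 2, \<sigma> 3, \<sigma> 4]"

lemma atLeastAtMost_4: "{1..4::nat} = {1, 2, 3, 4}"
  by auto

lemma perm_list_perms4:
  assumes "\<sigma> \<in> sym_grp 4"
  shows "perm_list \<sigma> \<in> set perms4"
proof -
  have p: "\<sigma> permutes {1, 2, 3, 4}" using assms by (simp only: sym_grp_def mem_Collect_eq atLeastAtMost_4)
  have "\<sigma> i \<in> {1, 2, 3, 4}" if "i \<in> {1, 2, 3, 4}" for i
    using permutes_in_image[OF p, of i] that by simp
  moreover have "distinct (perm_list \<sigma>)"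
    using permutes_inj[OF p] by (auto simp: perm_list_def inj_eq)
  ultimately show ?thesis
    unfolding perms4_def set_filter product_lists_set mem_Collect_eq by (simp add: perm_list_def)
qed

lemma inj_on_perm_list: "inj_on perm_list (sym_grp 4)"
proof (rule inj_onI)
  fix \<sigma> \<tau> assume s: "\<sigma> \<in> sym_grp 4" "\<tau> \<in> sym_grp 4" and e: "perm_list \<sigma> = perm_list \<tau>"
  show "\<sigma> = \<tau>"
  proof
    fix i
    show "\<sigma> i = \<tau> i"
    proof (cases "i \<in> {1..4}")
      case True
      then have "i = 1 \<or> i = 2 \<or> i = 3 \<or> i = 4" by auto
      then show ?thesis using e by (auto simp: perm_list_def)
    next
      case False
      then show ?thesis using s by (metis sym_grp_def mem_Collect_eq permutes_not_in)
    qed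
  qed
qed

lemma agree_perm_list: "\<exists>i\<in>{1..4}. \<sigma> i = \<tau> i \<Longrightarrow> agree (perm_list \<sigma>) (perm_list \<tau>)"
  unfolding atLeastAtMost_4 by (auto simp: perm_list_def)

lemma cross_intersecting_4_aux:
  assumes A: "A \<subseteq> sym_grp 4" and B: "B \<subseteq> sym_grp 4" and ci: "cross_intersecting 4 A B"
    and card: "card A * card B = 36" and le: "card A \<le> card B"
  shows "\<exists>i\<in>{1..4}. \<exists>j\<in>{1..4}. A = {\<sigma> \<in> sym_grp 4. \<sigma> i = j} \<and> B = {\<sigma> \<in> sym_grp 4. \<sigma> i = j}"
proof -
  have fin: "finite A" "finite B" using A B finite_sym_grp finite_subset by blast+
  have A6: "card A \<le> 6"
  proof (rule ccontr)
    assume "\<not> card A \<le> 6"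
    then have "7 * 7 \<le> card A * card B" using le by (intro mult_le_mono) auto
    then show False using card by simp
  qed
  have B6: "6 \<le> card B"
  proof (rule ccontr)
    assume "\<not> 6 \<le> card B"
    then have "card A * card B \<le> 5 * 5" using le by (intro mult_le_mono) auto
    then show False using card by simp
  qed
  have cA: "card (perm_list ` A) = card A" and cB: "card (perm_list ` B) = card B"
    using inj_on_subset[OF inj_on_perm_list] A B by (auto intro: card_image)
  define N where "N = filter (\<lambda>z. \<forall>y\<in>perm_list ` A. agree y z) perms4"
  have BN: "perm_list ` B \<subseteq> set N"
  proof
    fix z assume "z \<in> perm_list ` B"
    then obtain \<tau> where \<tau>: "\<tau> \<in> B" "z = perm_list \<tau>" by blast
    have "agree (perm_list \<sigma>) z" if "\<sigma> \<in> A" for \<sigma>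
      unfolding \<tau>(2) using ci \<tau>(1) that by (intro agree_perm_list) (auto simp: cross_intersecting_def)
    then show "z \<in> set N" using perm_list_perms4[of \<tau>] B \<tau> by (auto simp: N_def)
  qed
  have "card (perm_list ` B) \<le> card (set N)" using BN by (intro card_mono) auto
  also have "\<dots> = length N" by (rule distinct_card) (simp add: N_def distinct_perms4)
  finally have lN: "card B \<le> length N" using cB by simp
  have "\<exists>X'. set X' = set ([] :: nat list list) \<union> perm_list ` A \<and> length X' = length ([] :: nat list list) + card (perm_list ` A) \<and> small_or_dictator X' N"
    unfolding N_def
  proof (rule search_families_sound[OF search_families_perms4 distinct_perms4])
    show "perm_list ` A \<subseteq> set perms4" using A perm_list_perms4 by blast
    show "6 \<le> length (filter (\<lambda>z. \<forall>y\<in>perm_list ` A. agree y z) perms4)"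
      using lN B6 by (simp add: N_def)
  qed (use cA A6 in simp)
  then obtain X where X: "set X = perm_list ` A" "length X = card A" "small_or_dictator X N" using cA by auto
  \<comment> \<open>\<open>N\<close> contains all lists from \<open>B\<close>, so the product is too
    large for the first alternative of \<open>small_or_dictator\<close>.\<close>
  have "36 \<le> length X * length N" unfolding card[symmetric] X(2) using lN by simp
  then obtain i j where i: "i \<in> {0, 1, 2, 3}" and j: "j \<in> {1, 2, 3, 4}"
    and all: "\<forall>x\<in>set X \<union> set N. x ! i = j"
    using X(3) by (auto simp: small_or_dictator_def list_ex_iff list_all_iff)
  have ij: "Suc i \<in> {1..4}" "j \<in> {1..4}" using i j by auto
  have "perm_list \<sigma> ! i = \<sigma> (Suc i)" for \<sigma> using i by (auto simp: perm_list_def numeral_eq_Suc)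
  moreover have "perm_list \<sigma> ! i = j" if "\<sigma> \<in> A \<union> B" for \<sigma>
    using all X(1) BN that by blast
  ultimately have sub: "A \<subseteq> {\<sigma> \<in> sym_grp 4. \<sigma> (Suc i) = j}" "B \<subseteq> {\<sigma> \<in> sym_grp 4. \<sigma> (Suc i) = j}"
    using A B by force+
  have c6: "card {\<sigma> \<in> sym_grp 4. \<sigma> (Suc i) = j} = 6"
    using card_point_stabilizer_coset[OF ij] by (simp add: fact_numeral)
  have "finite {\<sigma> \<in> sym_grp 4. \<sigma> (Suc i) = j}" by simp
  from card_mono[OF this sub(2)] have B6': "card B = 6" using c6 B6 by simp
  then have "card A = 6" using card by simp
  then have "A = {\<sigma> \<in> sym_grp 4. \<sigma> (Suc i) = j}" "B = {\<sigma> \<in> sym_grp 4. \<sigma> (Suc i) = j}"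
    using card_subset_eq[OF _ sub(1)] card_subset_eq[OF _ sub(2)] c6 B6' by simp_all
  then show ?thesis using ij by blast
qed

lemma cross_intersecting_commute: "cross_intersecting n A B \<Longrightarrow> cross_intersecting n B A"
  unfolding cross_intersecting_def by (blast intro: sym)

lemma cross_intersecting_4:
  assumes "A \<subseteq> sym_grp 4" "B \<subseteq> sym_grp 4" "cross_intersecting 4 A B" "card A * card B = 36"
  shows "\<exists>i\<in>{1..4}. \<exists>j\<in>{1..4}. A = {\<sigma> \<in> sym_grp 4. \<sigma> i = j} \<and> B = {\<sigma> \<in> sym_grp 4. \<sigma> i = j}"
proof (cases "card A \<le> card B")
  case True
  then show ?thesis using assms by (intro cross_intersecting_4_aux)
next
  case False
  then have "\<exists>i\<in>{1..4}. \<exists>j\<in>{1..4}. B = {\<sigma> \<in> sym_grp 4. \<sigma> i = j} \<and> A = {\<sigma> \<in> sym_grp 4. \<sigma> i = j}"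
    using assms cross_intersecting_commute[OF assms(3)]
    by (intro cross_intersecting_4_aux) (auto simp: mult.commute)
  then show ?thesis by blast
qed

theorem theorem4:
  fixes n :: nat and A B :: "(nat \<Rightarrow> nat) set"
  assumes "n \<ge> 4"
    and "A \<subseteq> sym_grp n" and "B \<subseteq> sym_grp n"
    and "cross_intersecting n A B"
    and "card A * card B = (fact (n - 1))^2"
  shows "\<exists>i\<in>{1..n}. \<exists>j\<in>{1..n}.
           A = {\<sigma>\<in>sym_grp n. \<sigma> i = j} \<and> B = {\<sigma>\<in>sym_grp n. \<sigma> i = j}"
proof (cases "n = 4")
  case True
  then show ?thesis using assms cross_intersecting_4[of A B] by (simp add: fact_numeral)
next
  case False
  then have n: "5 \<le> n" using assms(1) by simp
  note * = hoffman_equality[OF n assms(2-5)]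
  have "\<exists>i\<in>{1..n}. \<exists>j\<in>{1..n}. A = {\<sigma>\<in>sym_grp n. \<sigma> i = j}"
    using n assms(2,4) * by (intro linear_intersecting_dictator) auto
  then show ?thesis using *(1) by simp
qed

end
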